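(* For all compact convex sets $A,B,C$ in $\mathbb{R}^3$, $$|A|\,|A+B+C|\le\frac43|A+B|\,|A+C|,$$ and the constant $\frac43$ is best possible (i.e. $c_3=\frac43$). Moreover, if $A$ is a simplex, then $|A|\,|A+B+C|\le|A+B|\,|A+C|$.
   Context: $|\cdot|$ is $3$-dimensional volume and $+$ is Minkowski addition. $c_n$ denotes the infimum of all constants $c>0$ such that $|A|\,|A+B+C|\le c\,|A+B|\,|A+C|$ holds for all compact convex sets $A,B,C$ in $\mathbb{R}^n$. *)

theory Defs
  imports "HOL-Analysis.Analysis"
begin

text \<open>Volume is Lebesgue measure; Minkowski addition of sets is the library's
  pointwise set sum (HOL-Library.Set_Algebras), A + B = {a + b | a b. a \<in> A, b \<in> B}.\<close>

definition vol :: "'a::euclidean_space set \<Rightarrow> real" where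
  "vol S = measure lebesgue S"

definition best_const :: "'a::euclidean_space itself \<Rightarrow> real" where
  "best_const (_ :: 'a itself) = Inf {c::real. c > 0 \<and>
     (\<forall>A B C :: 'a set. compact A \<and> convex A \<and> compact B \<and> convex B \<and> compact C \<and> convex C
        \<longrightarrow> vol A * vol (A + B + C) \<le> c * vol (A + B) * vol (A + C))}"

end

theory Submission
  imports Defs
begin

text \<open>The volume of \<open>x A + y B + z C\<close> is a cubic form in \<open>x, y, z \<ge> 0\<close>: for polytopes \<open>A\<close>, \<open>B\<close>, \<open>C\<close>
  the gradient of \<open>x \<phi>\<^sub>A + y \<phi>\<^sub>B + z \<phi>\<^sub>C\<close>, where \<open>\<phi>\<^sub>P w = ln (\<Sum>v\<in>P. exp (v \<bullet> w))\<close> for a vertex set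
  \<open>P\<close>, maps the space diffeomorphically onto the interior of \<open>x A + y B + z C\<close>, so that the volume is
  the integral of a Hessian determinant, which is cubic in \<open>(x, y, z)\<close>; general convex bodies are limits.
  By Brunn--Minkowski the cube root of this form is concave. Its second derivative at the vertex \<open>A\<close>
  yields Fenchel's inequality \<open>V(A,A,A) V(A,B,C) \<le> 2 V(A,A,B) V(A,A,C)\<close>, and the one at the vertex \<open>B\<close>
  yields \<open>V(A,A,B) V(B,B,C) \<le> 2 V(A,B,B) V(A,B,C)\<close>; together these give
  \<open>V(A,A,A) V(B,B,C) \<le> 4 V(A,B,B) V(A,A,C)\<close>, and the constant 4/3 follows by comparing coefficients.
  If \<open>A\<close> is a simplex, then \<open>C\<close> lies in a translate of \<open>\<rho> A\<close> with \<open>\<rho> V(A,A,A) \<le> V(A,A,C)\<close>, and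
  monotonicity of mixed volumes improves the constant to 1. A square pyramid together with two long
  orthogonal segments shows that 4/3 is optimal.\<close>

section \<open>Ternary cubic forms\<close>

text \<open>Recovering the coefficients of a cubic form by interpolation turns cubicity into a linear identity
  between values, which survives integration and pointwise limits.\<close>

definition interp_cubic :: "(real \<Rightarrow> real \<Rightarrow> real \<Rightarrow> real) \<Rightarrow> real \<Rightarrow> real \<Rightarrow> real \<Rightarrow> real" where
  "interp_cubic f x y z =
     f 1 0 0 * x^3 + f 0 1 0 * y^3 + f 0 0 1 * z^3
   + (f 2 1 0 - 2 * f 1 1 0 - 6 * f 1 0 0 + f 0 1 0) / 2 * x\<^sup>2 * y
   + (f 1 2 0 - 2 * f 1 1 0 - 6 * f 0 1 0 + f 1 0 0) / 2 * x * y\<^sup>2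
   + (f 2 0 1 - 2 * f 1 0 1 - 6 * f 1 0 0 + f 0 0 1) / 2 * x\<^sup>2 * z
   + (f 1 0 2 - 2 * f 1 0 1 - 6 * f 0 0 1 + f 1 0 0) / 2 * x * z\<^sup>2
   + (f 0 2 1 - 2 * f 0 1 1 - 6 * f 0 1 0 + f 0 0 1) / 2 * y\<^sup>2 * z
   + (f 0 1 2 - 2 * f 0 1 1 - 6 * f 0 0 1 + f 0 1 0) / 2 * y * z\<^sup>2
   + (f 1 1 1 - f 1 1 0 - f 1 0 1 - f 0 1 1 + f 1 0 0 + f 0 1 0 + f 0 0 1) * x * y * z"

definition cubic_form :: "(real \<Rightarrow> real \<Rightarrow> real \<Rightarrow> real) \<Rightarrow> bool" where
  "cubic_form f \<longleftrightarrow> (\<exists>a b c p q r s t u m. \<forall>x y z. f x y z =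
     a * x^3 + b * y^3 + c * z^3 + p * x\<^sup>2 * y + q * x * y\<^sup>2 + r * x\<^sup>2 * z + s * x * z\<^sup>2
     + t * y\<^sup>2 * z + u * y * z\<^sup>2 + m * x * y * z)"

lemma cubic_formI:
  assumes "\<And>x y z. f x y z =
     a * x^3 + b * y^3 + c * z^3 + p * x\<^sup>2 * y + q * x * y\<^sup>2 + r * x\<^sup>2 * z + s * x * z\<^sup>2
     + t * y\<^sup>2 * z + u * y * z\<^sup>2 + m * x * y * z"
  shows "cubic_form f"
  unfolding cubic_form_def using assms by blast

lemma cubic_form_interp:
  assumes "cubic_form f"
  shows "f x y z = interp_cubic f x y z"
proof -
  obtain a b c p q r s t u m where f: "\<And>x y z. f x y z =
     a * x^3 + b * y^3 + c * z^3 + p * x\<^sup>2 * y + q * x * y\<^sup>2 + r * x\<^sup>2 * z + s * x * z\<^sup>2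
     + t * y\<^sup>2 * z + u * y * z\<^sup>2 + m * x * y * z"
    using assms unfolding cubic_form_def by blast
  show ?thesis unfolding interp_cubic_def f by simp
qed

lemma cubic_form_add:
  assumes "cubic_form f" "cubic_form g"
  shows "cubic_form (\<lambda>x y z. f x y z + g x y z)"
proof -
  obtain a b c p q r s t u m where f: "\<And>x y z. f x y z =
     a * x^3 + b * y^3 + c * z^3 + p * x\<^sup>2 * y + q * x * y\<^sup>2 + r * x\<^sup>2 * z + s * x * z\<^sup>2
     + t * y\<^sup>2 * z + u * y * z\<^sup>2 + m * x * y * z"
    using assms(1) unfolding cubic_form_def by blast
  obtain a' b' c' p' q' r' s' t' u' m' where g: "\<And>x y z. g x y z =
     a' * x^3 + b' * y^3 + c' * z^3 + p' * x\<^sup>2 * y + q' * x * y\<^sup>2 + r' * x\<^sup>2 * z + s' * x * z\<^sup>2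
     + t' * y\<^sup>2 * z + u' * y * z\<^sup>2 + m' * x * y * z"
    using assms(2) unfolding cubic_form_def by blast
  show ?thesis
    by (rule cubic_formI[of _ "a+a'" "b+b'" "c+c'" "p+p'" "q+q'" "r+r'" "s+s'" "t+t'" "u+u'" "m+m'"])
       (simp add: f g algebra_simps)
qed

lemma cubic_form_minus:
  assumes "cubic_form f"
  shows "cubic_form (\<lambda>x y z. - f x y z)"
proof -
  obtain a b c p q r s t u m where f: "\<And>x y z. f x y z =
     a * x^3 + b * y^3 + c * z^3 + p * x\<^sup>2 * y + q * x * y\<^sup>2 + r * x\<^sup>2 * z + s * x * z\<^sup>2
     + t * y\<^sup>2 * z + u * y * z\<^sup>2 + m * x * y * z"
    using assms(1) unfolding cubic_form_def by blast
  show ?thesis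
    by (rule cubic_formI[of _ "-a" "-b" "-c" "-p" "-q" "-r" "-s" "-t" "-u" "-m"]) (simp add: f)
qed

lemma cubic_form_diff:
  "cubic_form f \<Longrightarrow> cubic_form g \<Longrightarrow> cubic_form (\<lambda>x y z. f x y z - g x y z)"
  using cubic_form_add[OF _ cubic_form_minus, of f g] by simp

lemma cubic_form_linear_product:
  "cubic_form (\<lambda>x y z. (x * a1 + y * b1 + z * c1) * (x * a2 + y * b2 + z * c2) * (x * a3 + y * b3 + z * c3))"
  by (rule cubic_formI[of _ "a1*a2*a3" "b1*b2*b3" "c1*c2*c3" "a1*a2*b3+a1*b2*a3+b1*a2*a3" "a1*b2*b3+b1*a2*b3+b1*b2*a3"
     "a1*a2*c3+a1*c2*a3+c1*a2*a3" "a1*c2*c3+c1*a2*c3+c1*c2*a3" "b1*b2*c3+b1*c2*b3+c1*b2*b3" "b1*c2*c3+c1*b2*c3+c1*c2*b3"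
     "a1*b2*c3+a1*c2*b3+b1*a2*c3+b1*c2*a3+c1*a2*b3+c1*b2*a3"])
     (simp add: algebra_simps power2_eq_square power3_eq_cube)

lemma cubic_form_det:
  fixes L M N :: "real^3 \<Rightarrow> real^3"
  shows "cubic_form (\<lambda>x y z. det (matrix (\<lambda>h. x *\<^sub>R L h + y *\<^sub>R M h + z *\<^sub>R N h)))"
  unfolding det_3 matrix_def
  by (simp, intro cubic_form_add cubic_form_diff cubic_form_linear_product)

lemma tendsto_interp_cubic:
  assumes "\<And>x y z. x \<ge> 0 \<Longrightarrow> y \<ge> 0 \<Longrightarrow> z \<ge> 0 \<Longrightarrow> (\<lambda>k. F k x y z) \<longlonglongrightarrow> f x y z"
  shows "(\<lambda>k. interp_cubic (F k) x y z) \<longlonglongrightarrow> interp_cubic f x y z"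
  unfolding interp_cubic_def by (intro tendsto_intros assms) auto

lemma has_integral_interp_cubic:
  fixes g :: "'n::euclidean_space \<Rightarrow> real \<Rightarrow> real \<Rightarrow> real \<Rightarrow> real"
  assumes "\<And>x y z. x \<ge> 0 \<Longrightarrow> y \<ge> 0 \<Longrightarrow> z \<ge> 0 \<Longrightarrow> x + y + z > 0 \<Longrightarrow> ((\<lambda>w. g w x y z) has_integral f x y z) S"
  shows "((\<lambda>w. interp_cubic (g w) x y z) has_integral interp_cubic f x y z) S"
  unfolding interp_cubic_def
  by (intro has_integral_add has_integral_diff has_integral_mult_left has_integral_mult_right has_integral_divide assms) auto

section \<open>The moment map of a polytope\<close>

definition expsum :: "'a::euclidean_space set \<Rightarrow> 'a \<Rightarrow> real" where
  "expsum P y = (\<Sum>v\<in>P. exp (v \<bullet> y))"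

text \<open>The gradient of \<open>ln (expsum P)\<close>; its derivative at \<open>y\<close> is the covariance operator of the
  probability weights \<open>exp (v \<bullet> y) / expsum P y\<close> on \<open>P\<close>.\<close>

definition moment_map :: "'a::euclidean_space set \<Rightarrow> 'a \<Rightarrow> 'a" where
  "moment_map P y = (\<Sum>v\<in>P. exp (v \<bullet> y) *\<^sub>R v) /\<^sub>R expsum P y"

definition moment_deriv :: "'a::euclidean_space set \<Rightarrow> 'a \<Rightarrow> 'a \<Rightarrow> 'a" where
  "moment_deriv P y h =
     (\<Sum>v\<in>P. (exp (v \<bullet> y) / expsum P y * ((v - moment_map P y) \<bullet> h)) *\<^sub>R (v - moment_map P y))"

lemma expsum_pos: "finite P \<Longrightarrow> P \<noteq> {} \<Longrightarrow> expsum P y > 0"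
  unfolding expsum_def by (intro sum_pos) auto

lemma moment_map_in_hull:
  assumes "finite P" "P \<noteq> {}"
  shows "moment_map P y \<in> convex hull P"
proof -
  have E: "expsum P y > 0" using assms by (rule expsum_pos)
  have "moment_map P y = (\<Sum>v\<in>P. (exp (v \<bullet> y) / expsum P y) *\<^sub>R v)"
    unfolding moment_map_def by (simp add: scaleR_sum_right divide_inverse_commute)
  moreover have "(\<Sum>v\<in>P. exp (v \<bullet> y) / expsum P y) = 1"
    using E by (simp add: sum_divide_distrib[symmetric] expsum_def)
  ultimately show ?thesis
    using E unfolding convex_hull_finite[OF assms(1)] by (auto intro!: exI[of _ "\<lambda>v. exp (v \<bullet> y) / expsum P y"])
qed

lemma has_derivative_ln_expsum:
  assumes "finite P" "P \<noteq> {}"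
  shows "((\<lambda>y. ln (expsum P y)) has_derivative (\<lambda>h. moment_map P y \<bullet> h)) (at y)"
proof -
  have E: "expsum P y > 0" using assms by (rule expsum_pos)
  have 1: "(expsum P has_derivative (\<lambda>h. \<Sum>v\<in>P. exp (v \<bullet> y) * (v \<bullet> h))) (at y)"
    unfolding expsum_def by (auto intro!: derivative_eq_intros simp: mult.commute)
  have "((\<lambda>y. ln (expsum P y)) has_derivative (\<lambda>h. (\<Sum>v\<in>P. exp (v \<bullet> y) * (v \<bullet> h)) * inverse (expsum P y))) (at y)"
    by (rule has_derivative_ln[OF E 1])
  moreover have "(\<lambda>h. (\<Sum>v\<in>P. exp (v \<bullet> y) * (v \<bullet> h)) * inverse (expsum P y)) = (\<lambda>h. moment_map P y \<bullet> h)"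
    by (auto simp: moment_map_def inner_sum_left sum_distrib_left mult.commute fun_eq_iff)
  ultimately show ?thesis by simp
qed

lemma moment_weight_zero:
  assumes "finite P" "P \<noteq> {}"
  shows "(\<Sum>v\<in>P. exp (v \<bullet> y) / expsum P y * ((v - moment_map P y) \<bullet> h)) = 0"
proof -
  have E: "expsum P y > 0" using assms by (rule expsum_pos)
  have "(\<Sum>v\<in>P. exp (v \<bullet> y) / expsum P y * ((v - moment_map P y) \<bullet> h))
     = (\<Sum>v\<in>P. exp (v \<bullet> y) * (v \<bullet> h)) / expsum P y - (\<Sum>v\<in>P. exp (v \<bullet> y)) / expsum P y * (moment_map P y \<bullet> h)"
    by (simp add: inner_diff_left right_diff_distrib sum_subtractf sum_divide_distrib sum_distrib_right)
  also have "\<dots> = (\<Sum>v\<in>P. exp (v \<bullet> y) * (v \<bullet> h)) / expsum P y - moment_map P y \<bullet> h"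
    using E by (simp add: expsum_def[symmetric])
  also have "\<dots> = 0" by (simp add: moment_map_def inner_sum_left divide_inverse_commute)
  finally show ?thesis .
qed

lemma has_derivative_moment_map:
  assumes "finite P" "P \<noteq> {}"
  shows "(moment_map P has_derivative moment_deriv P y) (at y)"
proof -
  have E: "expsum P y > 0" using assms by (rule expsum_pos)
  let ?S = "\<lambda>h. \<Sum>v\<in>P. exp (v \<bullet> y) * (v \<bullet> h)"
  have 1: "(expsum P has_derivative ?S) (at y)"
    unfolding expsum_def by (auto intro!: derivative_eq_intros simp: mult.commute)
  have 2: "((\<lambda>y. \<Sum>v\<in>P. exp (v \<bullet> y) *\<^sub>R v) has_derivative (\<lambda>h. \<Sum>v\<in>P. (exp (v \<bullet> y) * (v \<bullet> h)) *\<^sub>R v)) (at y)"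
    by (auto intro!: derivative_eq_intros simp: mult.commute)
  have 3: "((\<lambda>y. inverse (expsum P y)) has_derivative (\<lambda>h. - (inverse (expsum P y) * ?S h * inverse (expsum P y)))) (at y)"
    using E by (intro Deriv.has_derivative_inverse[OF _ 1]) auto
  have 4: "(moment_map P has_derivative
     (\<lambda>h. inverse (expsum P y) *\<^sub>R (\<Sum>v\<in>P. (exp (v \<bullet> y) * (v \<bullet> h)) *\<^sub>R v)
        + (- (inverse (expsum P y) * ?S h * inverse (expsum P y))) *\<^sub>R (\<Sum>v\<in>P. exp (v \<bullet> y) *\<^sub>R v))) (at y)"
    unfolding moment_map_def[abs_def] by (rule has_derivative_scaleR[OF 3 2])
  moreover have "inverse (expsum P y) *\<^sub>R (\<Sum>v\<in>P. (exp (v \<bullet> y) * (v \<bullet> h)) *\<^sub>R v)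
        + (- (inverse (expsum P y) * ?S h * inverse (expsum P y))) *\<^sub>R (\<Sum>v\<in>P. exp (v \<bullet> y) *\<^sub>R v)
      = moment_deriv P y h" for h
  proof -
    define g where "g = moment_map P y"
    have gS: "g \<bullet> h = inverse (expsum P y) * ?S h"
      by (simp add: g_def moment_map_def inner_sum_left)
    have "moment_deriv P y h = (\<Sum>v\<in>P. (exp (v \<bullet> y) / expsum P y * ((v - g) \<bullet> h)) *\<^sub>R v)
         - (\<Sum>v\<in>P. exp (v \<bullet> y) / expsum P y * ((v - g) \<bullet> h)) *\<^sub>R g"
      by (simp add: moment_deriv_def g_def scaleR_diff_right sum_subtractf scaleR_sum_left)
    also have "\<dots> = (\<Sum>v\<in>P. (exp (v \<bullet> y) / expsum P y * ((v - g) \<bullet> h)) *\<^sub>R v)"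
      using moment_weight_zero[OF assms, of y h] by (simp add: g_def)
    also have "\<dots> = inverse (expsum P y) *\<^sub>R (\<Sum>v\<in>P. (exp (v \<bullet> y) * (v \<bullet> h)) *\<^sub>R v)
        - (g \<bullet> h) *\<^sub>R (\<Sum>v\<in>P. (exp (v \<bullet> y) / expsum P y) *\<^sub>R v)"
      by (simp add: inner_diff_left right_diff_distrib scaleR_diff_left sum_subtractf scaleR_sum_right
           divide_inverse mult_ac)
    also have "(\<Sum>v\<in>P. (exp (v \<bullet> y) / expsum P y) *\<^sub>R v) = inverse (expsum P y) *\<^sub>R (\<Sum>v\<in>P. exp (v \<bullet> y) *\<^sub>R v)"
      by (simp add: scaleR_sum_right divide_inverse mult_ac)
    finally show ?thesis by (simp add: gS mult_ac)
  qed
  ultimately show ?thesis by (simp only:)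
qed

lemma moment_deriv_pos:
  assumes fin: "finite P" and int: "interior (convex hull P) \<noteq> {}" and h: "h \<noteq> 0"
  shows "h \<bullet> moment_deriv P y h > 0"
proof -
  have ne: "P \<noteq> {}" using int by auto
  have E: "expsum P y > 0" using fin ne by (rule expsum_pos)
  define g where "g = moment_map P y"
  have eq: "h \<bullet> moment_deriv P y h = (\<Sum>v\<in>P. exp (v \<bullet> y) / expsum P y * ((v - g) \<bullet> h)\<^sup>2)"
    by (simp add: moment_deriv_def g_def inner_sum_right power2_eq_square inner_commute mult_ac)
  have "\<exists>v\<in>P. (v - g) \<bullet> h \<noteq> 0"
  proof (rule ccontr)
    assume "\<not> ?thesis"
    then have "P \<subseteq> {x. h \<bullet> x = h \<bullet> g}" by (auto simp: inner_diff_left inner_commute[of h])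
    then have "convex hull P \<subseteq> {x. h \<bullet> x = h \<bullet> g}"
      by (intro hull_minimal convex_hyperplane)
    then have "interior (convex hull P) \<subseteq> interior {x. h \<bullet> x = h \<bullet> g}" by (rule interior_mono)
    then show False using int h by simp
  qed
  then obtain v where v: "v \<in> P" "(v - g) \<bullet> h \<noteq> 0" by auto
  have "(\<Sum>v\<in>P. exp (v \<bullet> y) / expsum P y * ((v - g) \<bullet> h)\<^sup>2) > 0"
    using E v by (intro sum_pos2[OF fin v(1)]) (auto intro!: divide_pos_pos mult_pos_pos)
  then show ?thesis by (simp only: eq)
qed

lemma inner_le_ln_expsum:
  assumes "finite P" "k \<in> convex hull P"
  shows "k \<bullet> y \<le> ln (expsum P y)"
proof -
  have ne: "P \<noteq> {}" using assms by auto
  have E: "expsum P y > 0" using assms(1) ne by (rule expsum_pos)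
  have "P \<subseteq> {x. y \<bullet> x \<le> ln (expsum P y)}"
  proof
    fix v assume v: "v \<in> P"
    have "exp (v \<bullet> y) \<le> expsum P y" unfolding expsum_def
      by (rule member_le_sum[OF v]) (use assms in auto)
    then show "v \<in> {x. y \<bullet> x \<le> ln (expsum P y)}" using E
      by (simp add: ln_ge_iff inner_commute)
  qed
  then have "convex hull P \<subseteq> {x. y \<bullet> x \<le> ln (expsum P y)}"
    by (intro hull_minimal convex_halfspace_le)
  then show ?thesis using assms by (auto simp: inner_commute)
qed

text \<open>The form need not be symmetric: the determinant does not vanish on the segment from the identity.\<close>

lemma det_pos_of_positive_form:
  fixes f :: "real^'n \<Rightarrow> real^'n"
  assumes lin: "linear f" and pos: "\<And>h. h \<noteq> 0 \<Longrightarrow> h \<bullet> f h > 0"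
  shows "det (matrix f) > 0"
proof -
  define M where "M t = (\<chi> i j. (1 - t) * (mat 1 :: real^'n^'n) $ i $ j + t * matrix f $ i $ j)" for t :: real
  have Mv: "M t *v h = (1 - t) *\<^sub>R h + t *\<^sub>R f h" for t h
  proof -
    have "M t *v h = (1 - t) *\<^sub>R (mat 1 *v h) + t *\<^sub>R (matrix f *v h)"
      by (simp add: M_def vec_eq_iff matrix_vector_mult_def sum.distrib sum_distrib_left distrib_right mult.assoc)
    then show ?thesis using lin by (simp add: matrix_works)
  qed
  have nz: "det (M t) \<noteq> 0" if t: "0 \<le> t" "t \<le> 1" for t
  proof
    assume "det (M t) = 0"
    then have "\<not> invertible (M t)" by (simp add: invertible_det_nz)
    then obtain h where h: "h \<noteq> 0" "M t *v h = 0"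
      using invertible_left_inverse[of "M t"] matrix_left_invertible_ker[of "M t"] by auto
    have "h \<bullet> (M t *v h) = (1 - t) * (h \<bullet> h) + t * (h \<bullet> f h)"
      by (simp add: Mv inner_add_right)
    moreover have "h \<bullet> h > 0" "h \<bullet> f h > 0" using h pos by auto
    then have "(1 - t) * (h \<bullet> h) + t * (h \<bullet> f h) > 0"
      using t by (cases "t = 0") (auto intro!: add_nonneg_pos)
    ultimately show False using h by simp
  qed
  have cont: "continuous_on {0..1} (\<lambda>t. det (M t))"
    unfolding det_def M_def by (simp, intro continuous_intros)
  have M0: "M 0 = mat 1" and M1: "M 1 = matrix f" by (simp_all add: M_def vec_eq_iff)
  show ?thesis
  proof (rule ccontr)
    assume "\<not> ?thesis"
    then have "det (M 1) \<le> 0" "0 \<le> det (M 0)" by (simp_all add: M0 M1)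
    then obtain t where "0 \<le> t" "t \<le> 1" "det (M t) = 0"
      using IVT2'[of "\<lambda>t. det (M t)" 1 0 0] cont by auto
    then show False using nz by blast
  qed
qed


lemma compact_set_plus:
  fixes S T :: "'a::real_normed_vector set"
  assumes "compact S" "compact T"
  shows "compact (S + T)"
  unfolding set_plus_image split_def
  by (intro compact_continuous_image compact_Times assms continuous_intros)

lemma linear_moment_deriv: "linear (moment_deriv P y)"
  unfolding moment_deriv_def
  by (intro linearI) (simp_all add: inner_add_right distrib_left scaleR_add_left sum.distrib scaleR_sum_right mult_ac)

lemma polytope_sum_volume:
  fixes P Q R :: "(real^'n::{finite,wellorder}) set"
  assumes fin: "finite P" "finite Q" "finite R"
    and int: "interior (convex hull P) \<noteq> {}" "interior (convex hull Q) \<noteq> {}" "interior (convex hull R) \<noteq> {}"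
    and nn: "x \<ge> 0" "y \<ge> 0" "z \<ge> 0" "x + y + z > 0"
  shows "((\<lambda>w. det (matrix (\<lambda>h. x *\<^sub>R moment_deriv P w h + y *\<^sub>R moment_deriv Q w h + z *\<^sub>R moment_deriv R w h)))
     has_integral measure lebesgue
       ((*\<^sub>R) x ` (convex hull P) + (*\<^sub>R) y ` (convex hull Q) + (*\<^sub>R) z ` (convex hull R))) UNIV"
proof -
  define K where "K = (*\<^sub>R) x ` (convex hull P) + (*\<^sub>R) y ` (convex hull Q) + (*\<^sub>R) z ` (convex hull R)"
  define G where "G w = x *\<^sub>R moment_map P w + y *\<^sub>R moment_map Q w + z *\<^sub>R moment_map R w" for w
  define D where "D w h = x *\<^sub>R moment_deriv P w h + y *\<^sub>R moment_deriv Q w h + z *\<^sub>R moment_deriv R w h" for w h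
  have ne: "P \<noteq> {}" "Q \<noteq> {}" "R \<noteq> {}" using int by auto
  have linD: "linear (D w)" for w
    unfolding D_def by (intro linear_compose_add linear_compose_scale_right linear_moment_deriv)
  have derG: "(G has_derivative D w) (at w within S)" for w S
    unfolding G_def[abs_def] D_def
    by (intro derivative_intros has_derivative_at_withinI[OF has_derivative_moment_map] fin ne)
  have posD: "h \<bullet> D w h > 0" if h: "h \<noteq> 0" for w h
  proof -
    have 1: "h \<bullet> moment_deriv P w h > 0" "h \<bullet> moment_deriv Q w h > 0" "h \<bullet> moment_deriv R w h > 0"
      by (intro moment_deriv_pos fin int h)+
    have "h \<bullet> D w h = x * (h \<bullet> moment_deriv P w h) + y * (h \<bullet> moment_deriv Q w h) + z * (h \<bullet> moment_deriv R w h)"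
      by (simp add: D_def inner_add_right)
    moreover have "x > 0 \<or> y > 0 \<or> z > 0" using nn by linarith
    ultimately show ?thesis using 1 nn
      by (smt (verit) mult_nonneg_nonneg mult_pos_pos)
  qed
  have inj: "inj G"
  proof (rule injI, rule ccontr)
    fix u w assume eq: "G u = G w" and "u \<noteq> w"
    define h where "h = w - u"
    have h: "h \<noteq> 0" using \<open>u \<noteq> w\<close> by (simp add: h_def)
    have "((\<lambda>t. h \<bullet> G (u + t *\<^sub>R h)) has_real_derivative (h \<bullet> D (u + t *\<^sub>R h) h)) (at t)" for t
    proof -
      have "((\<lambda>t. u + t *\<^sub>R h) has_derivative (\<lambda>s. s *\<^sub>R h)) (at t)"
        by (auto intro!: derivative_eq_intros)
      from has_derivative_compose[OF this derG]
      have "((\<lambda>t. G (u + t *\<^sub>R h)) has_derivative (\<lambda>s. D (u + t *\<^sub>R h) (s *\<^sub>R h))) (at t)" .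
      then have "((\<lambda>t. h \<bullet> G (u + t *\<^sub>R h)) has_derivative (\<lambda>s. h \<bullet> D (u + t *\<^sub>R h) (s *\<^sub>R h))) (at t)"
        by (rule has_derivative_inner_right)
      then show ?thesis
        by (rule has_derivative_imp_has_field_derivative) (simp add: linear_scale[OF linD] mult.commute)
    qed
    then have "h \<bullet> G (u + 0 *\<^sub>R h) < h \<bullet> G (u + 1 *\<^sub>R h)"
      by (intro DERIV_pos_imp_increasing[of 0 1 "\<lambda>t. h \<bullet> G (u + t *\<^sub>R h)"]) (use posD[OF h] in \<open>auto intro!: exI\<close>)
    then show False using eq by (simp add: h_def)
  qed
  have detpos: "det (matrix (D w)) > 0" for w
    by (rule det_pos_of_positive_form[OF linD posD])
  have sub: "range G \<subseteq> K"
    unfolding K_def G_def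
    by (intro image_subsetI set_plus_intro imageI moment_map_in_hull fin ne)
  have sup: "interior K \<subseteq> range G"
  proof
    fix u assume "u \<in> interior K"
    then obtain r where r: "r > 0" "cball u r \<subseteq> K" by (meson mem_interior_cball)
    define F where "F w = x * ln (expsum P w) + y * ln (expsum Q w) + z * ln (expsum R w) - u \<bullet> w" for w
    have derF: "(F has_derivative (\<lambda>h. (G w - u) \<bullet> h)) (at w)" for w
    proof -
      have "(F has_derivative (\<lambda>h. x * (moment_map P w \<bullet> h) + y * (moment_map Q w \<bullet> h) + z * (moment_map R w \<bullet> h) - u \<bullet> h)) (at w)"
        unfolding F_def[abs_def]
        by (intro has_derivative_diff has_derivative_add has_derivative_mult_right has_derivative_inner_right
              has_derivative_ident has_derivative_ln_expsum fin ne)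
      then show ?thesis by (simp add: G_def inner_add_left inner_diff_left)
    qed
    have growth: "F w \<ge> r * norm w" for w
    proof (cases "w = 0")
      case True
      have "expsum P 0 \<ge> 1" "expsum Q 0 \<ge> 1" "expsum R 0 \<ge> 1"
        using fin ne by (simp_all add: expsum_def Suc_le_eq card_gt_0_iff)
      then show ?thesis using nn True by (simp add: F_def)
    next
      case False
      define k where "k = u + (r / norm w) *\<^sub>R w"
      have "k \<in> cball u r" using r False by (simp add: k_def dist_norm)
      then have "k \<in> K" using r by blast
      then obtain p q s where k: "k = x *\<^sub>R p + y *\<^sub>R q + z *\<^sub>R s"
        and pqs: "p \<in> convex hull P" "q \<in> convex hull Q" "s \<in> convex hull R"
        unfolding K_def by (elim set_plus_elim imageE) blast
      have "k \<bullet> w \<le> x * ln (expsum P w) + y * ln (expsum Q w) + z * ln (expsum R w)"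
        unfolding k inner_add_left inner_scaleR_left
        using inner_le_ln_expsum fin pqs nn by (intro add_mono mult_left_mono) auto
      moreover have "k \<bullet> w = u \<bullet> w + r * norm w"
        using False by (simp add: k_def inner_add_left dot_square_norm power2_eq_square)
      ultimately show ?thesis by (simp add: F_def)
    qed
    define B where "B = cball (u - u) (F 0 / r)"
    have F0: "F 0 \<ge> 0" using growth[of 0] by simp
    have "continuous_on B F"
      using derF by (intro continuous_at_imp_continuous_on ballI has_derivative_continuous)
    moreover have "compact B" "B \<noteq> {}" using F0 r by (auto simp: B_def divide_less_0_iff)
    ultimately obtain w0 where w0: "w0 \<in> B" "\<And>w. w \<in> B \<Longrightarrow> F w0 \<le> F w"
      using continuous_attains_inf by metis
    have min: "F w0 \<le> F w" for w
    proof (cases "w \<in> B")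
      case False
      then have "r * norm w > F 0" using r by (simp add: B_def field_simps)
      moreover have "F w0 \<le> F 0" using w0 F0 r by (auto simp: B_def divide_less_0_iff)
      ultimately show ?thesis using growth[of w] by linarith
    qed (use w0 in auto)
    have "(\<lambda>h. (G w0 - u) \<bullet> h) = (\<lambda>h. 0)"
      by (rule differential_zero_maxmin[OF UNIV_I open_UNIV derF]) (simp add: min)
    then have "(G w0 - u) \<bullet> (G w0 - u) = 0" by (rule fun_cong)
    then show "u \<in> range G" by auto
  qed
  have cK: "convex K" "compact K"
    unfolding K_def using fin
    by (auto intro!: convex_set_plus convex_scaling compact_set_plus compact_scaling finite_imp_compact_convex_hull)
  have "negligible (frontier K)" using cK by (simp add: negligible_convex_frontier)
  moreover have "sym_diff K (range G) \<subseteq> frontier K"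
    using sub sup cK by (auto simp: frontier_def closure_closed compact_imp_closed)
  ultimately have "negligible (sym_diff K (range G))" by (rule negligible_subset)
  moreover have "K \<in> lmeasurable" using cK by (simp add: lmeasurable_compact)
  ultimately have "range G \<in> lmeasurable \<and> measure lebesgue (range G) = measure lebesgue K"
    using lmeasurable_negligible_symdiff[of K "range G"] measure_negligible_symdiff[of K "range G"] by blast
  then have "((\<lambda>w. \<bar>det (matrix (D w))\<bar>) has_integral measure lebesgue K) UNIV"
    using has_measure_differentiable_image[of UNIV G D "measure lebesgue K"] derG inj by auto
  then show ?thesis
    using detpos by (simp add: K_def D_def[abs_def] less_imp_le abs_of_pos)
qed

section \<open>Polynomiality of volume\<close>

lemma finite_subset_hull_interior:
  fixes K :: "'a::euclidean_space set"
  assumes "interior K \<noteq> {}"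
  obtains P where "finite P" "P \<subseteq> K" "interior (convex hull P) \<noteq> {}"
proof -
  obtain x where "x \<in> interior K" using assms by blast
  then obtain a b where ab: "cbox a b \<subseteq> interior K" "x \<in> box a b"
    using open_contains_cbox[OF open_interior] by metis
  obtain P where P: "finite P" "cbox a b = convex hull P"
    using closed_interval_as_convex_hull by blast
  have "P \<subseteq> K" using P ab hull_subset[of P convex] interior_subset[of K] by blast
  moreover have "interior (convex hull P) \<noteq> {}" using P(2) ab(2) by (metis empty_iff interior_cbox)
  ultimately show thesis using that P by blast
qed

lemma finite_exhaustion:
  fixes K :: "'a::euclidean_space set"
  assumes "interior K \<noteq> {}"
  obtains F :: "nat \<Rightarrow> 'a set" where "\<And>n. finite (F n)" "incseq F" "\<And>n. F n \<subseteq> K"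
    "\<And>n. interior (convex hull F n) \<noteq> {}" "K \<subseteq> closure (\<Union>n. F n)"
proof -
  obtain P where P: "finite P" "P \<subseteq> K" "interior (convex hull P) \<noteq> {}"
    using finite_subset_hull_interior[OF assms] .
  obtain T where T: "countable T" "T \<subseteq> K" "K \<subseteq> closure T"
    using separable[of K] by blast
  have Tne: "T \<noteq> {}" using T assms by auto
  define F where "F n = P \<union> from_nat_into T ` {..<n}" for n
  have "T \<subseteq> (\<Union>n. F n)"
  proof
    fix t assume "t \<in> T"
    then have "from_nat_into T (to_nat_on T t) = t" using T(1) by simp
    then have "t \<in> F (Suc (to_nat_on T t))" by (force simp: F_def)
    then show "t \<in> (\<Union>n. F n)" by blast
  qed
  then have "K \<subseteq> closure (\<Union>n. F n)" using T(3) closure_mono by blast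
  moreover have "interior (convex hull F n) \<noteq> {}" for n
    using P(3) interior_mono[OF hull_mono[of P "F n" convex]] by (auto simp: F_def)
  moreover have "F n \<subseteq> K" for n using P T from_nat_into[OF Tne] by (auto simp: F_def)
  moreover have "incseq F" by (force simp: F_def incseq_def)
  moreover have "finite (F n)" for n using P by (simp add: F_def)
  ultimately show thesis using that by blast
qed

lemma measure_dense_convex_Union:
  fixes K :: "nat \<Rightarrow> 'a::euclidean_space set"
  assumes comp: "\<And>n. compact (K n)" and conv: "\<And>n. convex (K n)" and inc: "incseq K"
    and sub: "\<And>n. K n \<subseteq> L" and L: "compact L" and dense: "L \<subseteq> closure (\<Union>n. K n)"
  shows "(\<lambda>n. measure lebesgue (K n)) \<longlonglongrightarrow> measure lebesgue L"
proof -
  let ?U = "\<Union>n. K n"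
  have meas: "K n \<in> lmeasurable" for n using comp by (simp add: lmeasurable_compact)
  have Lm: "L \<in> lmeasurable" using L by (simp add: lmeasurable_compact)
  have bound: "measure lebesgue (K n) \<le> measure lebesgue L" for n
    using measure_mono_fmeasurable[OF sub _ Lm] meas by blast
  have lim: "(\<lambda>n. measure lebesgue (K n)) \<longlonglongrightarrow> measure lebesgue ?U"
    by (rule measure_nested_Union[OF meas bound]) (use inc in \<open>auto simp: incseq_Suc_iff\<close>)
  have Um: "?U \<in> lmeasurable"
    by (rule measurable_nested_Union[OF meas bound]) (use inc in \<open>auto simp: incseq_Suc_iff\<close>)
  have "convex ?U"
  proof (rule convexI)
    fix x y and u v :: real
    assume "x \<in> ?U" "y \<in> ?U" and uv: "0 \<le> u" "0 \<le> v" "u + v = 1"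
    then obtain m n where "x \<in> K m" "y \<in> K n" by blast
    moreover have "K m \<subseteq> K (max m n)" "K n \<subseteq> K (max m n)" using incseqD[OF inc, of m "max m n"] incseqD[OF inc, of n "max m n"] by simp_all
    ultimately have "x \<in> K (max m n)" "y \<in> K (max m n)" by blast+
    then have "u *\<^sub>R x + v *\<^sub>R y \<in> K (max m n)" using convexD[OF conv] uv by blast
    then show "u *\<^sub>R x + v *\<^sub>R y \<in> ?U" by blast
  qed
  then have "negligible (frontier ?U)" by (rule negligible_convex_frontier)
  moreover have "?U \<subseteq> L" using sub by blast
  then have "(?U - L) \<union> (L - ?U) \<subseteq> frontier ?U"
    using dense interior_subset[of ?U] by (auto simp: frontier_def)
  ultimately have "negligible ((?U - L) \<union> (L - ?U))" by (rule negligible_subset)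
  then have "measure lebesgue L = measure lebesgue ?U" by (rule measure_negligible_symdiff[OF Um])
  then show ?thesis using lim by simp
qed

definition comb3 :: "'a::real_vector set \<Rightarrow> 'a set \<Rightarrow> 'a set \<Rightarrow> real \<Rightarrow> real \<Rightarrow> real \<Rightarrow> 'a set" where
  "comb3 A B C x y z = (*\<^sub>R) x ` A + (*\<^sub>R) y ` B + (*\<^sub>R) z ` C"

lemma compact_comb3:
  fixes A B C :: "'a::real_normed_vector set"
  shows "compact A \<Longrightarrow> compact B \<Longrightarrow> compact C \<Longrightarrow> compact (comb3 A B C x y z)"
  unfolding comb3_def by (intro compact_set_plus compact_scaling)

lemma convex_comb3: "convex A \<Longrightarrow> convex B \<Longrightarrow> convex C \<Longrightarrow> convex (comb3 A B C x y z)"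
  unfolding comb3_def by (intro convex_set_plus convex_scaling)

lemma comb3_mono: "A \<subseteq> A' \<Longrightarrow> B \<subseteq> B' \<Longrightarrow> C \<subseteq> C' \<Longrightarrow> comb3 A B C x y z \<subseteq> comb3 A' B' C' x y z"
  unfolding comb3_def by (intro set_plus_mono2 image_mono)

lemma polytope_volume_cubic:
  fixes P Q R :: "(real^3) set"
  assumes fin: "finite P" "finite Q" "finite R"
    and int: "interior (convex hull P) \<noteq> {}" "interior (convex hull Q) \<noteq> {}" "interior (convex hull R) \<noteq> {}"
    and nn: "x \<ge> 0" "y \<ge> 0" "z \<ge> 0"
  defines "f \<equiv> \<lambda>x y z. measure lebesgue (comb3 (convex hull P) (convex hull Q) (convex hull R) x y z)"
  shows "f x y z = interp_cubic f x y z"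
proof (cases "x + y + z > 0")
  case True
  define g where "g w x y z = det (matrix (\<lambda>h. x *\<^sub>R moment_deriv P w h + y *\<^sub>R moment_deriv Q w h + z *\<^sub>R moment_deriv R w h))" for w x y z
  have gf: "((\<lambda>w. g w x y z) has_integral f x y z) UNIV"
    if "x \<ge> 0" "y \<ge> 0" "z \<ge> 0" "x + y + z > 0" for x y z
    unfolding g_def f_def comb3_def by (rule polytope_sum_volume[OF fin int that])
  have "((\<lambda>w. interp_cubic (g w) x y z) has_integral interp_cubic f x y z) UNIV"
    by (rule has_integral_interp_cubic[OF gf])
  moreover have "interp_cubic (g w) x y z = g w x y z" for w
    using cubic_form_interp[OF cubic_form_det] unfolding g_def by metis
  ultimately have "((\<lambda>w. g w x y z) has_integral interp_cubic f x y z) UNIV" by simp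
  then show ?thesis using gf[OF nn True] has_integral_unique by blast
next
  case False
  then have 0: "x = 0" "y = 0" "z = 0" using nn by auto
  have "comb3 (convex hull P) (convex hull Q) (convex hull R) 0 0 0 \<subseteq> {0}"
    by (auto simp: comb3_def set_plus_def)
  then have "f 0 0 0 = 0"
    unfolding f_def using negligible_subset[OF negligible_sing] negligible_imp_measure0 by blast
  then show ?thesis using 0 by (simp add: interp_cubic_def)
qed

lemma convex_volume_cubic:
  fixes A B C :: "(real^3) set"
  assumes A: "compact A" "convex A" "interior A \<noteq> {}"
    and B: "compact B" "convex B" "interior B \<noteq> {}"
    and C: "compact C" "convex C" "interior C \<noteq> {}"
    and nn: "x \<ge> 0" "y \<ge> 0" "z \<ge> 0"
  defines "f \<equiv> \<lambda>x y z. measure lebesgue (comb3 A B C x y z)"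
  shows "f x y z = interp_cubic f x y z"
proof -
  obtain P :: "nat \<Rightarrow> (real^3) set" where P: "\<And>n. finite (P n)" "incseq P" "\<And>n. P n \<subseteq> A"
    "\<And>n. interior (convex hull P n) \<noteq> {}" "A \<subseteq> closure (\<Union>n. P n)"
    using finite_exhaustion[OF A(3)] by blast
  obtain Q :: "nat \<Rightarrow> (real^3) set" where Q: "\<And>n. finite (Q n)" "incseq Q" "\<And>n. Q n \<subseteq> B"
    "\<And>n. interior (convex hull Q n) \<noteq> {}" "B \<subseteq> closure (\<Union>n. Q n)"
    using finite_exhaustion[OF B(3)] by blast
  obtain R :: "nat \<Rightarrow> (real^3) set" where R: "\<And>n. finite (R n)" "incseq R" "\<And>n. R n \<subseteq> C"
    "\<And>n. interior (convex hull R n) \<noteq> {}" "C \<subseteq> closure (\<Union>n. R n)"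
    using finite_exhaustion[OF C(3)] by blast
  define f' where "f' n x y z = measure lebesgue (comb3 (convex hull P n) (convex hull Q n) (convex hull R n) x y z)" for n x y z
  have lim: "(\<lambda>n. f' n x y z) \<longlonglongrightarrow> f x y z" for x y z
    unfolding f'_def f_def
  proof (rule measure_dense_convex_Union)
    let ?K = "\<lambda>n. comb3 (convex hull P n) (convex hull Q n) (convex hull R n) x y z"
    show "compact (?K n)" for n
      by (intro compact_comb3 finite_imp_compact_convex_hull P Q R)
    show "convex (?K n)" for n
      by (intro convex_comb3 convex_convex_hull)
    show "incseq ?K"
      unfolding incseq_def
      by (intro allI impI comb3_mono hull_mono incseqD[OF P(2)] incseqD[OF Q(2)] incseqD[OF R(2)])
    show "?K n \<subseteq> comb3 A B C x y z" for n
      by (intro comb3_mono hull_minimal P Q R A B C)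
    show "compact (comb3 A B C x y z)" by (intro compact_comb3 A B C)
    have "comb3 (\<Union>n. P n) (\<Union>n. Q n) (\<Union>n. R n) x y z \<subseteq> (\<Union>n. ?K n)"
    proof
      fix k assume "k \<in> comb3 (\<Union>n. P n) (\<Union>n. Q n) (\<Union>n. R n) x y z"
      then obtain a b c i j l where k: "k = x *\<^sub>R a + y *\<^sub>R b + z *\<^sub>R c" "a \<in> P i" "b \<in> Q j" "c \<in> R l"
        unfolding comb3_def by (elim set_plus_elim imageE UN_E) blast
      let ?n = "max i (max j l)"
      have "a \<in> convex hull P ?n" "b \<in> convex hull Q ?n" "c \<in> convex hull R ?n"
        using k(2-) subsetD[OF incseqD[OF P(2), of i ?n]] subsetD[OF incseqD[OF Q(2), of j ?n]]
          subsetD[OF incseqD[OF R(2), of l ?n]]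
        by (intro hull_inc; simp add: max.coboundedI2)+
      then have "k \<in> ?K ?n" unfolding comb3_def k(1) by blast
      then show "k \<in> (\<Union>n. ?K n)" by blast
    qed
    then have "closure (comb3 (\<Union>n. P n) (\<Union>n. Q n) (\<Union>n. R n) x y z) \<subseteq> closure (\<Union>n. ?K n)"
      by (rule closure_mono)
    moreover have "comb3 A B C x y z \<subseteq> comb3 (closure (\<Union>n. P n)) (closure (\<Union>n. Q n)) (closure (\<Union>n. R n)) x y z"
      by (intro comb3_mono P Q R)
    moreover have "\<dots> \<subseteq> closure (comb3 (\<Union>n. P n) (\<Union>n. Q n) (\<Union>n. R n) x y z)"
      unfolding comb3_def closure_scaleR
      by (intro order.trans[OF _ closure_sum] set_plus_mono2 order.refl)
    ultimately show "comb3 A B C x y z \<subseteq> closure (\<Union>n. ?K n)" by blast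
  qed
  have "(\<lambda>n. interp_cubic (f' n) x y z) \<longlonglongrightarrow> interp_cubic f x y z"
    by (rule tendsto_interp_cubic[OF lim])
  moreover have "interp_cubic (f' n) x y z = f' n x y z" for n
    unfolding f'_def using polytope_volume_cubic[OF P(1) Q(1) R(1) P(4) Q(4) R(4) nn, of n n n] by simp
  ultimately have "(\<lambda>n. f' n x y z) \<longlonglongrightarrow> interp_cubic f x y z" by simp
  then show ?thesis using lim LIMSEQ_unique by blast
qed

section \<open>The Brunn--Minkowski inequality\<close>

definition vol_radius :: "'a::euclidean_space set \<Rightarrow> real" where
  "vol_radius S = root DIM('a) (measure lebesgue S)"

lemma vol_radius_nonneg [simp]: "vol_radius S \<ge> 0"
  by (simp add: vol_radius_def)

lemma vol_radius_power: "vol_radius (S::'a::euclidean_space set) ^ DIM('a) = measure lebesgue S"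
  by (simp add: vol_radius_def)

lemma vol_radius_le_iff:
  fixes S :: "'a::euclidean_space set"
  assumes "r \<ge> 0"
  shows "r \<le> vol_radius S \<longleftrightarrow> r ^ DIM('a) \<le> measure lebesgue S"
  using assms by (metis DIM_positive power_mono_iff vol_radius_nonneg vol_radius_power)

lemma root_prod_superadditive:
  fixes u v :: "'b \<Rightarrow> real"
  assumes fin: "finite I" "I \<noteq> {}" and pos: "\<And>i. i \<in> I \<Longrightarrow> u i > 0" "\<And>i. i \<in> I \<Longrightarrow> v i > 0"
  shows "root (card I) (\<Prod>i\<in>I. u i) + root (card I) (\<Prod>i\<in>I. v i) \<le> root (card I) (\<Prod>i\<in>I. u i + v i)"
proof -
  let ?n = "card I"
  have n: "?n > 0" using fin by (simp add: card_gt_0_iff)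
  have amgm: "root ?n (\<Prod>i\<in>I. w i) \<le> (\<Sum>i\<in>I. w i) / ?n" if "\<And>i. i \<in> I \<Longrightarrow> w i \<ge> 0" for w :: "'b \<Rightarrow> real"
  proof (cases "(\<Prod>i\<in>I. w i) = 0")
    case True
    then show ?thesis using that by (simp add: sum_nonneg)
  next
    case False
    then have "(\<Prod>i\<in>I. w i) > 0" using that by (simp add: prod_nonneg less_le)
    then show ?thesis
      using arith_geom_mean[OF fin(1) fin(2), of w] that n by (simp add: root_powr_inverse sum_divide_distrib)
  qed
  define s where "s i = u i + v i" for i
  have s: "s i > 0" if "i \<in> I" for i using pos[OF that] by (simp add: s_def)
  have prodpos: "(\<Prod>i\<in>I. s i) > 0" using s by (simp add: prod_pos)
  have "root ?n (\<Prod>i\<in>I. u i) / root ?n (\<Prod>i\<in>I. s i) + root ?n (\<Prod>i\<in>I. v i) / root ?n (\<Prod>i\<in>I. s i)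
      = root ?n (\<Prod>i\<in>I. u i / s i) + root ?n (\<Prod>i\<in>I. v i / s i)"
    by (simp add: prod_dividef real_root_divide)
  also have "\<dots> \<le> (\<Sum>i\<in>I. u i / s i) / ?n + (\<Sum>i\<in>I. v i / s i) / ?n"
    using pos s by (intro add_mono amgm) (auto intro!: divide_nonneg_nonneg less_imp_le)
  also have "\<dots> = (\<Sum>i\<in>I. u i / s i + v i / s i) / ?n"
    by (simp add: sum.distrib add_divide_distrib)
  also have "(\<Sum>i\<in>I. u i / s i + v i / s i) = (\<Sum>i\<in>I. 1)"
    using s by (intro sum.cong) (auto simp: s_def add_divide_distrib[symmetric] less_le)
  also have "(\<Sum>i\<in>I. 1) / real ?n = 1" using n by simp
  finally have "(root ?n (\<Prod>i\<in>I. u i) + root ?n (\<Prod>i\<in>I. v i)) / root ?n (\<Prod>i\<in>I. s i) \<le> 1"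
    by (simp add: add_divide_distrib)
  then show ?thesis
    using prodpos n by (simp add: s_def divide_le_eq real_root_gt_0_iff split: if_splits)
qed

lemma Brunn_Minkowski_cbox:
  fixes a b c d :: "'a::euclidean_space"
  assumes ne: "box a b \<noteq> {}" "box c d \<noteq> {}"
  shows "vol_radius (cbox a b) + vol_radius (cbox c d) \<le> vol_radius (cbox a b + cbox c d)"
proof -
  have lt: "\<And>i. i \<in> Basis \<Longrightarrow> a \<bullet> i < b \<bullet> i" "\<And>i. i \<in> Basis \<Longrightarrow> c \<bullet> i < d \<bullet> i"
    using ne by (auto simp: box_ne_empty)
  have sub: "cbox (a + c) (b + d) \<subseteq> cbox a b + cbox c d"
  proof
    fix x assume x: "x \<in> cbox (a + c) (b + d)"
    define p where "p = (\<Sum>i\<in>Basis. max (a \<bullet> i) (x \<bullet> i - d \<bullet> i) *\<^sub>R i)"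
    have pi: "p \<bullet> i = max (a \<bullet> i) (x \<bullet> i - d \<bullet> i)" if "i \<in> Basis" for i
      using that by (simp add: p_def inner_sum_left inner_Basis if_distrib sum.delta' cong: if_cong)
    have "p \<in> cbox a b"
      unfolding mem_box using x lt by (auto simp: pi mem_box inner_add_left less_imp_le)
    moreover have "x - p \<in> cbox c d"
      unfolding mem_box using x lt by (fastforce simp: pi mem_box inner_add_left inner_diff_left max_def)
    ultimately have "p + (x - p) \<in> cbox a b + cbox c d" by (rule set_plus_intro)
    then show "x \<in> cbox a b + cbox c d" by simp
  qed
  have vol: "measure lebesgue (cbox a b) = (\<Prod>i\<in>Basis. b \<bullet> i - a \<bullet> i)"
    "measure lebesgue (cbox c d) = (\<Prod>i\<in>Basis. d \<bullet> i - c \<bullet> i)"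
    "measure lebesgue (cbox (a + c) (b + d)) = (\<Prod>i\<in>Basis. (b \<bullet> i - a \<bullet> i) + (d \<bullet> i - c \<bullet> i))"
    using lt by (auto simp: content_cbox_if box_eq_empty inner_add_left inner_diff_left intro!: prod.cong)
       (smt (verit))+
  have "vol_radius (cbox a b) + vol_radius (cbox c d) \<le> vol_radius (cbox (a + c) (b + d))"
    unfolding vol_radius_def vol using lt by (intro root_prod_superadditive) auto
  also have "\<dots> \<le> vol_radius (cbox a b + cbox c d)"
    unfolding vol_radius_def
    by (intro real_root_le_mono DIM_positive measure_mono_fmeasurable sub)
       (auto intro!: lmeasurable_compact compact_set_plus)
  finally show ?thesis .
qed

definition box_family :: "'a::euclidean_space set set \<Rightarrow> bool" where
  "box_family \<A> \<longleftrightarrow> finite \<A> \<and> (\<forall>K\<in>\<A>. interior K \<noteq> {} \<and> (\<exists>c d. K = cbox c d))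
     \<and> pairwise (\<lambda>K L. interior K \<inter> interior L = {}) \<A>"

lemma box_family_compact: "box_family \<A> \<Longrightarrow> compact (\<Union>\<A>)"
  unfolding box_family_def by (intro compact_Union) auto

lemma box_family_measure_pos:
  assumes "box_family \<A>" "\<A> \<noteq> {}"
  shows "measure lebesgue (\<Union>\<A>) > 0"
proof -
  obtain K where K: "K \<in> \<A>" using assms by blast
  then have "interior K \<noteq> {}" using assms by (auto simp: box_family_def)
  then have "interior (\<Union>\<A>) \<noteq> {}" using K interior_mono[of K "\<Union>\<A>"] by blast
  then have "\<not> negligible (\<Union>\<A>)" using negligible_imp_measure0
    by (metis interior_subset negligible_subset open_interior open_not_negligible)
  then show ?thesis
    using box_family_compact[OF assms(1)] lmeasurable_compact negligible_iff_measure0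
    by (metis measure_nonneg order_le_less)
qed

lemma box_family_restrict:
  fixes \<A> :: "'a::euclidean_space set set"
  assumes A: "box_family \<A>" and box: "\<And>c d. \<exists>c' d'. cbox c d \<inter> H = cbox c' d'"
  defines "\<A>' \<equiv> {K \<inter> H | K. K \<in> \<A> \<and> interior (K \<inter> H) \<noteq> {}}"
  shows "box_family \<A>'" "\<Union>\<A>' \<subseteq> \<Union>\<A> \<inter> H" "measure lebesgue (\<Union>\<A>') = measure lebesgue (\<Union>\<A> \<inter> H)"
    "card \<A>' \<le> card \<A>" "\<And>K. K \<in> \<A> \<Longrightarrow> interior (K \<inter> H) = {} \<Longrightarrow> card \<A>' < card \<A>"
proof -
  have fin: "finite \<A>" using A by (simp add: box_family_def)
  have eq: "\<A>' = (\<lambda>K. K \<inter> H) ` {K \<in> \<A>. interior (K \<inter> H) \<noteq> {}}" by (auto simp: \<A>'_def)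
  show "\<Union>\<A>' \<subseteq> \<Union>\<A> \<inter> H" by (auto simp: \<A>'_def)
  have isbox: "\<exists>c d. K \<inter> H = cbox c d" if "K \<in> \<A>" for K
    using that A box unfolding box_family_def by metis
  show fam: "box_family \<A>'"
    unfolding box_family_def
  proof (intro conjI)
    show "finite \<A>'" using fin by (simp add: eq)
    show "\<forall>K\<in>\<A>'. interior K \<noteq> {} \<and> (\<exists>c d. K = cbox c d)"
      using isbox by (auto simp: \<A>'_def)
    show "pairwise (\<lambda>K L. interior K \<inter> interior L = {}) \<A>'"
    proof (rule pairwiseI)
      fix K' L' assume "K' \<in> \<A>'" "L' \<in> \<A>'" "K' \<noteq> L'"
      then obtain K L where "K' = K \<inter> H" "L' = L \<inter> H" "K \<in> \<A>" "L \<in> \<A>" "K \<noteq> L"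
        by (auto simp: \<A>'_def)
      moreover from this have "interior K \<inter> interior L = {}"
        using A by (simp add: box_family_def pairwise_def)
      ultimately show "interior K' \<inter> interior L' = {}" by auto
    qed
  qed
  have "negligible (K \<inter> H)" if "K \<in> \<A>" "interior (K \<inter> H) = {}" for K
    using isbox[OF that(1)] that(2) negligible_convex_interior by (metis convex_box(1))
  then have "negligible (\<Union>K\<in>{K \<in> \<A>. interior (K \<inter> H) = {}}. K \<inter> H)"
    using fin by (intro negligible_Union) auto
  moreover have "(\<Union>\<A>' - \<Union>\<A> \<inter> H) \<union> (\<Union>\<A> \<inter> H - \<Union>\<A>') \<subseteq> (\<Union>K\<in>{K \<in> \<A>. interior (K \<inter> H) = {}}. K \<inter> H)"
    by (auto simp: \<A>'_def)
  ultimately have "negligible ((\<Union>\<A>' - \<Union>\<A> \<inter> H) \<union> (\<Union>\<A> \<inter> H - \<Union>\<A>'))" by (rule negligible_subset)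
  then show "measure lebesgue (\<Union>\<A>') = measure lebesgue (\<Union>\<A> \<inter> H)"
    using measure_negligible_symdiff lmeasurable_compact box_family_compact[OF fam] by metis
  have le: "card \<A>' \<le> card {K \<in> \<A>. interior (K \<inter> H) \<noteq> {}}"
    unfolding eq using fin by (intro card_image_le) auto
  also have "\<dots> \<le> card \<A>" using fin by (intro card_mono) auto
  finally show "card \<A>' \<le> card \<A>" .
  show "card \<A>' < card \<A>" if "K \<in> \<A>" "interior (K \<inter> H) = {}" for K
  proof -
    have "{K \<in> \<A>. interior (K \<inter> H) \<noteq> {}} \<subset> \<A>" using that by blast
    then show ?thesis using le psubset_card_mono[OF fin] by (meson le_less_trans)
  qed
qed

lemma cbox_Int_halfspace:
  fixes c d :: "'a::euclidean_space"
  assumes "i \<in> Basis"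
  shows "\<exists>c' d'. cbox c d \<inter> {x. x \<bullet> i \<le> t} = cbox c' d'" "\<exists>c' d'. cbox c d \<inter> {x. x \<bullet> i \<ge> t} = cbox c' d'"
  using interval_split[OF assms] by blast+

lemma measure_halfspace_split:
  fixes S :: "'a::euclidean_space set"
  assumes S: "compact S" and i: "i \<in> Basis"
  shows "measure lebesgue S = measure lebesgue (S \<inter> {x. x \<bullet> i \<le> t}) + measure lebesgue (S \<inter> {x. x \<bullet> i \<ge> t})"
proof -
  have eq: "S = (S \<inter> {x. x \<bullet> i \<le> t}) \<union> (S \<inter> {x. x \<bullet> i \<ge> t})" by auto
  have "closed {x. x \<bullet> i \<le> t}" "closed {x. x \<bullet> i \<ge> t}"
    using closed_halfspace_le[of i t] closed_halfspace_ge[of t i] by (simp_all add: inner_commute)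
  then have m: "S \<inter> {x. x \<bullet> i \<le> t} \<in> lmeasurable" "S \<inter> {x. x \<bullet> i \<ge> t} \<in> lmeasurable"
    using S by (auto intro!: lmeasurable_compact compact_Int_closed)
  have "negligible {x. i \<bullet> x = t}" using i by (intro negligible_hyperplane) auto
  then have neg: "negligible ((S \<inter> {x. x \<bullet> i \<le> t}) \<inter> (S \<inter> {x. x \<bullet> i \<ge> t}))"
    by (rule negligible_subset) (auto simp: inner_commute)
  show ?thesis
    by (subst eq, subst measure_Un3_negligible[where U="{}", simplified]) (use m neg in auto)
qed

lemma measure_halfspace_bisect:
  fixes S :: "'a::euclidean_space set"
  assumes S: "compact S" and i: "i \<in> Basis" and \<theta>: "0 \<le> \<theta>" "\<theta> \<le> 1"
  obtains t where "measure lebesgue (S \<inter> {x. x \<bullet> i \<le> t}) = \<theta> * measure lebesgue S"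
proof -
  define \<phi> where "\<phi> t = measure lebesgue (S \<inter> {x. x \<bullet> i \<le> t})" for t
  have clo: "closed {x. x \<bullet> i \<le> t}" for t
    using closed_halfspace_le[of i t] by (simp add: inner_commute)
  have m: "S \<inter> {x. x \<bullet> i \<le> t} \<in> lmeasurable" for t
    using S clo by (auto intro!: lmeasurable_compact compact_Int_closed)
  obtain a b where ab: "S \<subseteq> cbox a b"
    using S bounded_subset_cbox_symmetric compact_imp_bounded by metis
  have slab: "\<phi> t' \<le> \<phi> t + measure lborel (cbox a b \<inter> {x. \<bar>x \<bullet> i - c\<bar> \<le> d})"
    if "\<bar>t - c\<bar> \<le> d" "\<bar>t' - c\<bar> \<le> d" for t t' c d
  proof -
    have "S \<inter> {x. x \<bullet> i \<le> t'} \<subseteq> (S \<inter> {x. x \<bullet> i \<le> t}) \<union> (cbox a b \<inter> {x. \<bar>x \<bullet> i - c\<bar> \<le> d})"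
      using ab that by (auto simp: abs_le_iff)
    moreover have "\<exists>u v. cbox a b \<inter> {x. \<bar>x \<bullet> i - c\<bar> \<le> d} = cbox u v"
      using interval_doublesplit[OF i] by blast
    then have m2: "cbox a b \<inter> {x. \<bar>x \<bullet> i - c\<bar> \<le> d} \<in> lmeasurable" by force
    ultimately have "\<phi> t' \<le> measure lebesgue ((S \<inter> {x. x \<bullet> i \<le> t}) \<union> (cbox a b \<inter> {x. \<bar>x \<bullet> i - c\<bar> \<le> d}))"
      unfolding \<phi>_def using m m2 by (intro measure_mono_fmeasurable) (auto simp: fmeasurableD)
    also have "\<dots> \<le> \<phi> t + measure lebesgue (cbox a b \<inter> {x. \<bar>x \<bullet> i - c\<bar> \<le> d})"
      unfolding \<phi>_def using m m2 by (intro measure_Un_le) (auto simp: fmeasurableD)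
    also have "measure lebesgue (cbox a b \<inter> {x. \<bar>x \<bullet> i - c\<bar> \<le> d}) = measure lborel (cbox a b \<inter> {x. \<bar>x \<bullet> i - c\<bar> \<le> d})"
      using \<open>\<exists>u v. _\<close> by force
    finally show ?thesis .
  qed
  have cont: "isCont \<phi> c" for c
    unfolding continuous_at_eps_delta
  proof (intro allI impI)
    fix e :: real assume "e > 0"
    then obtain d where d: "d > 0" "measure lborel (cbox a b \<inter> {x. \<bar>x \<bullet> i - c\<bar> \<le> d}) < e"
      using content_doublesplit[OF _ i] by metis
    have "dist (\<phi> x) (\<phi> c) < e" if "dist x c < d" for x
      using slab[of x c d c] slab[of c c d x] that d by (auto simp: dist_real_def)
    then show "\<exists>d>0. \<forall>x. dist x c < d \<longrightarrow> dist (\<phi> x) (\<phi> c) < e" using d by blast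
  qed
  define l u where "l = min (a \<bullet> i) (b \<bullet> i) - 1" and "u = max (a \<bullet> i) (b \<bullet> i)"
  have bnd: "a \<bullet> i \<le> x \<bullet> i \<and> x \<bullet> i \<le> b \<bullet> i" if "x \<in> S" for x using that ab i by (auto simp: mem_box)
  have "S \<inter> {x. x \<bullet> i \<le> l} = {}" using bnd by (force simp: l_def)
  moreover have "S \<inter> {x. x \<bullet> i \<le> u} = S" using bnd by (force simp: u_def)
  ultimately have "\<phi> l = 0" "\<phi> u = measure lebesgue S" by (simp_all add: \<phi>_def)
  moreover have "l \<le> u" by (simp add: l_def u_def)
  ultimately obtain t where "\<phi> t = \<theta> * measure lebesgue S"
    using IVT[of \<phi> l "\<theta> * measure lebesgue S" u] cont \<theta> by (auto simp: mult_left_le_one_le)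
  then show thesis using that by (simp add: \<phi>_def)
qed


lemma box_family_separated:
  assumes A: "box_family \<A>" and K: "K \<in> \<A>" "L \<in> \<A>" "K \<noteq> L"
  obtains i t where "i \<in> Basis"
    "(K \<subseteq> {x. x \<bullet> i \<le> t} \<and> L \<subseteq> {x. x \<bullet> i \<ge> t}) \<or> (L \<subseteq> {x. x \<bullet> i \<le> t} \<and> K \<subseteq> {x. x \<bullet> i \<ge> t})"
proof -
  obtain a b c d where ab: "K = cbox a b" "box a b \<noteq> {}" and cd: "L = cbox c d" "box c d \<noteq> {}"
    using A K unfolding box_family_def by (metis interior_cbox)
  have "box a b \<inter> box c d = {}"
    using A K unfolding box_family_def pairwise_def ab cd by (metis interior_cbox)
  then obtain i where i: "i \<in> Basis" "min (b \<bullet> i) (d \<bullet> i) \<le> max (a \<bullet> i) (c \<bullet> i)"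
    unfolding box_Int_box box_eq_empty by (auto simp: inner_sum_left inner_Basis if_distrib cong: if_cong)
  moreover have "a \<bullet> i < b \<bullet> i" "c \<bullet> i < d \<bullet> i" using ab cd i(1) by (auto simp: box_ne_empty)
  ultimately have "b \<bullet> i \<le> c \<bullet> i \<or> d \<bullet> i \<le> a \<bullet> i" by linarith
  then show thesis
  proof
    assume "b \<bullet> i \<le> c \<bullet> i"
    then show thesis using i(1) by (intro that[of i "b \<bullet> i"]) (force simp: ab cd mem_box)+
  next
    assume "d \<bullet> i \<le> a \<bullet> i"
    then show thesis using i(1) by (intro that[of i "d \<bullet> i"]) (force simp: ab cd mem_box)+
  qed
qed

lemma interior_halfspace_opposite:
  fixes K :: "'a::euclidean_space set"
  assumes "i \<in> Basis"
  shows "K \<subseteq> {x. x \<bullet> i \<ge> t} \<Longrightarrow> interior (K \<inter> {x. x \<bullet> i \<le> t}) = {}"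
    "K \<subseteq> {x. x \<bullet> i \<le> t} \<Longrightarrow> interior (K \<inter> {x. x \<bullet> i \<ge> t}) = {}"
proof -
  have i: "i \<noteq> 0" using assms by auto
  have e: "interior {x. i \<bullet> x = t} = {}" using i by simp
  show "interior (K \<inter> {x. x \<bullet> i \<le> t}) = {}" if "K \<subseteq> {x. x \<bullet> i \<ge> t}"
    using interior_mono[of "K \<inter> {x. x \<bullet> i \<le> t}" "{x. i \<bullet> x = t}"] that e by (force simp: inner_commute)
  show "interior (K \<inter> {x. x \<bullet> i \<ge> t}) = {}" if "K \<subseteq> {x. x \<bullet> i \<le> t}"
    using interior_mono[of "K \<inter> {x. x \<bullet> i \<ge> t}" "{x. i \<bullet> x = t}"] that e by (force simp: inner_commute)
qed

text \<open>Hadwiger--Ohmann induction: a hyperplane separating two boxes of \<open>\<A>\<close>, and a parallel one cutting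
  \<open>\<Union>\<B>\<close> in the same volume ratio, split the pair into two pairs with fewer boxes.\<close>

lemma Brunn_Minkowski_box_family:
  fixes \<A> \<B> :: "'a::euclidean_space set set"
  assumes "box_family \<A>" "box_family \<B>" "\<A> \<noteq> {}" "\<B> \<noteq> {}"
  shows "vol_radius (\<Union>\<A>) + vol_radius (\<Union>\<B>) \<le> vol_radius (\<Union>\<A> + \<Union>\<B>)"
  using assms
proof (induction "card \<A> + card \<B>" arbitrary: \<A> \<B> rule: less_induct)
  case less
  have split: "vol_radius (\<Union>\<A>) + vol_radius (\<Union>\<B>) \<le> vol_radius (\<Union>\<A> + \<Union>\<B>)"
    if A: "box_family \<A>" "\<A> \<noteq> {}" and B: "box_family \<B>" "\<B> \<noteq> {}" and c2: "card \<A> \<ge> 2"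
      and IH: "\<And>\<A>' \<B>' :: 'a set set. card \<A>' + card \<B>' < card \<A> + card \<B> \<Longrightarrow> box_family \<A>' \<Longrightarrow> box_family \<B>' \<Longrightarrow>
         \<A>' \<noteq> {} \<Longrightarrow> \<B>' \<noteq> {} \<Longrightarrow> vol_radius (\<Union>\<A>') + vol_radius (\<Union>\<B>') \<le> vol_radius (\<Union>\<A>' + \<Union>\<B>')"
    for \<A> \<B> :: "'a set set"
  proof -
    let ?n = "DIM('a)"
    obtain K L where KL: "K \<in> \<A>" "L \<in> \<A>" "K \<noteq> L"
      using c2 by (metis One_nat_def Suc_1 card_le_Suc0_iff_eq card_eq_0_iff not_less_eq_eq zero_le)
    then obtain i t where i: "i \<in> Basis" and KLt: "(K \<subseteq> {x. x \<bullet> i \<le> t} \<and> L \<subseteq> {x. x \<bullet> i \<ge> t}) \<or> (L \<subseteq> {x. x \<bullet> i \<le> t} \<and> K \<subseteq> {x. x \<bullet> i \<ge> t})"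
      using box_family_separated[OF A(1)] by metis
    obtain P Q where P: "P \<in> \<A>" "P \<subseteq> {x. x \<bullet> i \<le> t}" and Q: "Q \<in> \<A>" "Q \<subseteq> {x. x \<bullet> i \<ge> t}"
      using KL KLt by blast
    define lo hi where "lo s = {x::'a. x \<bullet> i \<le> s}" and "hi s = {x::'a. x \<bullet> i \<ge> s}" for s
    have clo: "closed (lo s)" "closed (hi s)" for s
      unfolding lo_def hi_def using closed_halfspace_le[of i s] closed_halfspace_ge[of s i]
      by (simp_all add: inner_commute)
    have box_lo: "\<exists>c' d'. cbox c d \<inter> lo s = cbox c' d'" and box_hi: "\<exists>c' d'. cbox c d \<inter> hi s = cbox c' d'" for c d s
      unfolding lo_def hi_def by (rule cbox_Int_halfspace[OF i])+
    define restr where "restr \<C> H = {K \<inter> H | K. K \<in> \<C> \<and> interior (K \<inter> H) \<noteq> {}}" for \<C> :: "'a set set" and H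
    define V where "V \<C> = measure lebesgue (\<Union>\<C>)" for \<C> :: "'a set set"
    note restr_lo = box_family_restrict[OF _ box_lo, folded restr_def V_def]
    note restr_hi = box_family_restrict[OF _ box_hi, folded restr_def V_def]
    have Vsplit: "V \<C> = V (restr \<C> (lo s)) + V (restr \<C> (hi s))" if "box_family \<C>" for \<C> s
      using measure_halfspace_split[OF box_family_compact[OF that] i, of s] restr_lo(3)[OF that, of s] restr_hi(3)[OF that, of s]
      by (simp add: V_def lo_def hi_def)
    have Vpos: "V \<C> > 0" if "box_family \<C>" "\<C> \<noteq> {}" for \<C>
      using box_family_measure_pos[OF that] by (simp add: V_def)
    have Vne: "\<C> \<noteq> {}" if "V \<C> > 0" for \<C> using that by (auto simp: V_def)
    have PQ: "P \<inter> lo t = P" "Q \<inter> hi t = Q" using P Q by (auto simp: lo_def hi_def)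
    have "restr \<A> (lo t) \<noteq> {}" "restr \<A> (hi t) \<noteq> {}"
    proof -
      have "interior P \<noteq> {}" "interior Q \<noteq> {}" using P(1) Q(1) A(1) by (auto simp: box_family_def)
      then have "P \<in> restr \<A> (lo t)" "Q \<in> restr \<A> (hi t)"
        using P(1) Q(1) PQ unfolding restr_def by (metis (mono_tags, lifting) mem_Collect_eq)+
      then show "restr \<A> (lo t) \<noteq> {}" "restr \<A> (hi t) \<noteq> {}" by blast+
    qed
    then have VA: "V (restr \<A> (lo t)) > 0" "V (restr \<A> (hi t)) > 0"
      using Vpos restr_lo(1)[OF A(1)] restr_hi(1)[OF A(1)] by blast+
    have cA: "card (restr \<A> (lo t)) < card \<A>" "card (restr \<A> (hi t)) < card \<A>"
      using restr_lo(5)[OF A(1) Q(1), of t] restr_hi(5)[OF A(1) P(1), of t]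
        interior_halfspace_opposite[OF i] P(2) Q(2) by (auto simp: lo_def hi_def)
    define \<theta> where "\<theta> = V (restr \<A> (lo t)) / V \<A>"
    have \<theta>: "0 < \<theta>" "\<theta> < 1" "V (restr \<A> (lo t)) = \<theta> * V \<A>" "V (restr \<A> (hi t)) = (1 - \<theta>) * V \<A>"
      using VA Vsplit[OF A(1), of t] by (auto simp: \<theta>_def field_simps)
    obtain s where s: "measure lebesgue (\<Union>\<B> \<inter> lo s) = \<theta> * V \<B>"
      using measure_halfspace_bisect[OF box_family_compact[OF B(1)] i, of \<theta>] \<theta> unfolding lo_def V_def
      by (metis less_imp_le)
    have VB: "V (restr \<B> (lo s)) = \<theta> * V \<B>" "V (restr \<B> (hi s)) = (1 - \<theta>) * V \<B>"
      using s restr_lo(3)[OF B(1), of s] Vsplit[OF B(1), of s] by (auto simp: algebra_simps)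
    define r where "r = vol_radius (\<Union>\<A>) + vol_radius (\<Union>\<B>)"
    have r0: "r \<ge> 0" by (simp add: r_def)
    have part: "\<tau> * r ^ ?n \<le> measure lebesgue (\<Union>\<A>' + \<Union>\<B>')"
      if "card \<A>' < card \<A>" "card \<B>' \<le> card \<B>" "box_family \<A>'" "box_family \<B>'" "\<tau> > 0"
        "V \<A>' = \<tau> * V \<A>" "V \<B>' = \<tau> * V \<B>" for \<tau> \<A>' \<B>'
    proof -
      have "V \<A>' > 0" "V \<B>' > 0"
        unfolding that(6,7) using that(5) Vpos[OF A] Vpos[OF B] by simp_all
      then have "\<A>' \<noteq> {}" "\<B>' \<noteq> {}" using Vne by blast+
      then have "vol_radius (\<Union>\<A>') + vol_radius (\<Union>\<B>') \<le> vol_radius (\<Union>\<A>' + \<Union>\<B>')"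
        using IH[of \<A>' \<B>'] that by simp
      moreover have "vol_radius (\<Union>\<A>') = root ?n \<tau> * vol_radius (\<Union>\<A>)"
        "vol_radius (\<Union>\<B>') = root ?n \<tau> * vol_radius (\<Union>\<B>)"
        using that by (simp_all add: vol_radius_def real_root_mult V_def)
      ultimately have "root ?n \<tau> * r \<le> vol_radius (\<Union>\<A>' + \<Union>\<B>')" by (simp add: r_def distrib_left)
      then have "(root ?n \<tau> * r) ^ ?n \<le> measure lebesgue (\<Union>\<A>' + \<Union>\<B>')"
        using vol_radius_le_iff r0 that by (metis mult_nonneg_nonneg less_imp_le real_root_pos_pos_le)
      then show ?thesis using that by (simp add: power_mult_distrib)
    qed
    define S where "S = \<Union>\<A> + \<Union>\<B>"
    have S: "compact S" unfolding S_def by (intro compact_set_plus box_family_compact A B)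
    have sum_lo: "(X \<inter> lo t) + (Y \<inter> lo s) \<subseteq> (X + Y) \<inter> lo (t + s)"
      and sum_hi: "(X \<inter> hi t) + (Y \<inter> hi s) \<subseteq> (X + Y) \<inter> hi (t + s)" for X Y :: "'a set"
      by (auto simp: lo_def hi_def inner_add_left elim!: set_plus_elim)
    have lo: "\<Union>(restr \<A> (lo t)) + \<Union>(restr \<B> (lo s)) \<subseteq> S \<inter> lo (t + s)"
      by (rule order.trans[OF set_plus_mono2[OF restr_lo(2)[OF A(1), of t] restr_lo(2)[OF B(1), of s]] sum_lo, folded S_def])
    have hi: "\<Union>(restr \<A> (hi t)) + \<Union>(restr \<B> (hi s)) \<subseteq> S \<inter> hi (t + s)"
      by (rule order.trans[OF set_plus_mono2[OF restr_hi(2)[OF A(1), of t] restr_hi(2)[OF B(1), of s]] sum_hi, folded S_def])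
    have m: "S \<inter> lo (t + s) \<in> lmeasurable" "S \<inter> hi (t + s) \<in> lmeasurable"
      using S clo by (auto intro!: lmeasurable_compact compact_Int_closed)
    have "r ^ ?n = \<theta> * r ^ ?n + (1 - \<theta>) * r ^ ?n" by (simp add: algebra_simps)
    also have "\<dots> \<le> measure lebesgue (\<Union>(restr \<A> (lo t)) + \<Union>(restr \<B> (lo s)))
        + measure lebesgue (\<Union>(restr \<A> (hi t)) + \<Union>(restr \<B> (hi s)))"
      using \<theta> VB cA A B restr_lo(1,4) restr_hi(1,4)
      by (intro add_mono part) auto
    also have "\<dots> \<le> measure lebesgue (S \<inter> lo (t + s)) + measure lebesgue (S \<inter> hi (t + s))"
      using m lo hi A B restr_lo(1) restr_hi(1)
      by (intro add_mono measure_mono_fmeasurable)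
         (auto intro!: fmeasurableD lmeasurable_compact compact_set_plus box_family_compact)
    also have "\<dots> = measure lebesgue S"
      using measure_halfspace_split[OF S i, of "t + s"] by (simp add: lo_def hi_def)
    finally have "r \<le> vol_radius S" using vol_radius_le_iff[OF r0] by blast
    then show ?thesis by (simp add: S_def r_def)
  qed
  consider "card \<A> \<ge> 2" | "card \<B> \<ge> 2" | "card \<A> < 2" "card \<B> < 2" by linarith
  then show ?case
  proof cases
    case 1
    show ?thesis by (rule split) (use less 1 in auto)
  next
    case 2
    have "vol_radius (\<Union>\<B>) + vol_radius (\<Union>\<A>) \<le> vol_radius (\<Union>\<B> + \<Union>\<A>)"
      by (rule split) (use less 2 in \<open>auto simp: add.commute\<close>)
    then show ?thesis by (simp add: add.commute)
  next
    case 3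
    have "finite \<A>" "finite \<B>" using less.prems by (auto simp: box_family_def)
    then have "card \<A> = 1" "card \<B> = 1"
      using 3 less.prems card_gt_0_iff[of \<A>] card_gt_0_iff[of \<B>] by linarith+
    then obtain K L where KL: "\<A> = {K}" "\<B> = {L}" by (metis card_1_singletonE)
    have "(\<exists>a b. K = cbox a b) \<and> interior K \<noteq> {}" "(\<exists>c d. L = cbox c d) \<and> interior L \<noteq> {}"
      using less.prems unfolding KL box_family_def by simp_all
    then obtain a b c d where "K = cbox a b" "L = cbox c d" "interior K \<noteq> {}" "interior L \<noteq> {}"
      by blast
    then show ?thesis unfolding KL using Brunn_Minkowski_cbox[of a b c d] by (simp add: interior_cbox)
  qed
qed

lemma box_family_exhaustion:
  fixes K :: "'a::euclidean_space set"
  assumes K: "compact K" "convex K" "interior K \<noteq> {}"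
  obtains \<A> :: "nat \<Rightarrow> 'a set set" where "\<And>n. box_family (\<A> n)" "\<And>n. \<A> n \<noteq> {}" "\<And>n. \<Union>(\<A> n) \<subseteq> K"
    "(\<lambda>n. vol_radius (\<Union>(\<A> n))) \<longlonglongrightarrow> vol_radius K"
proof -
  let ?S = "interior K"
  obtain a where a: "K \<subseteq> cbox (-a) a" using bounded_subset_cbox_symmetric[OF compact_imp_bounded[OF K(1)]] by blast
  then have sub: "?S \<subseteq> cbox (-a) a" using interior_subset by blast
  moreover have "box (-a) a \<noteq> {}"
    using interior_mono[OF a] K(3) by (auto simp: interior_cbox)
  moreover have "gauge (\<lambda>x. if x \<in> ?S then ?S else UNIV)" by (simp add: gauge_def)
  ultimately obtain \<D> where D: "countable \<D>" "\<And>K. K \<in> \<D> \<Longrightarrow> interior K \<noteq> {} \<and> (\<exists>c d. K = cbox c d)"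
    "pairwise (\<lambda>A B. interior A \<inter> interior B = {}) \<D>"
    "\<And>L. L \<in> \<D> \<Longrightarrow> \<exists>x \<in> ?S \<inter> L. L \<subseteq> (if x \<in> ?S then ?S else UNIV)" "?S \<subseteq> \<Union>\<D>"
    by (rule covering_lemma) blast
  have Dsub: "L \<subseteq> ?S" if "L \<in> \<D>" for L using D(4)[OF that] by auto
  have Dne: "\<D> \<noteq> {}" using D(5) K(3) by auto
  define \<A> where "\<A> n = from_nat_into \<D> ` {..n}" for n
  have AD: "\<A> n \<subseteq> \<D>" for n using from_nat_into[OF Dne] by (auto simp: \<A>_def)
  have fam: "box_family (\<A> n)" for n
    unfolding box_family_def using AD[of n] D(2) pairwise_subset[OF D(3) AD] by (auto simp: \<A>_def)
  have meas: "\<Union>(\<A> n) \<in> lmeasurable" for n by (intro lmeasurable_compact box_family_compact fam)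
  have Am: "\<Union>(\<A> n) \<subseteq> K" for n using AD Dsub interior_subset by blast
  have "(\<Union>n. \<Union>(\<A> n)) = ?S"
  proof
    show "(\<Union>n. \<Union>(\<A> n)) \<subseteq> ?S" using AD Dsub by blast
    show "?S \<subseteq> (\<Union>n. \<Union>(\<A> n))"
    proof
      fix x assume "x \<in> ?S"
      then obtain L where L: "L \<in> \<D>" "x \<in> L" using D(5) by blast
      have "from_nat_into \<D> (to_nat_on \<D> L) = L" using D(1) L by simp
      then have "L \<in> \<A> (to_nat_on \<D> L)" by (force simp: \<A>_def)
      then show "x \<in> (\<Union>n. \<Union>(\<A> n))" using L by blast
    qed
  qed
  moreover have "(\<lambda>n. measure lebesgue (\<Union>(\<A> n))) \<longlonglongrightarrow> measure lebesgue (\<Union>n. \<Union>(\<A> n))"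
  proof (rule measure_nested_Union[OF meas])
    show "measure lebesgue (\<Union>(\<A> n)) \<le> measure lebesgue K" for n
      using meas Am K by (intro measure_mono_fmeasurable) (auto intro: fmeasurableD lmeasurable_compact)
    show "\<Union>(\<A> n) \<subseteq> \<Union>(\<A> (Suc n))" for n
      unfolding \<A>_def by (intro Union_mono image_mono) auto
  qed
  moreover have "measure lebesgue ?S = measure lebesgue K"
  proof (rule measure_negligible_symdiff)
    show "K \<in> lmeasurable" using K by (simp add: lmeasurable_compact)
    show "negligible ((K - ?S) \<union> (?S - K))"
      by (rule negligible_subset[OF negligible_convex_frontier[OF K(2)]])
         (use interior_subset[of K] closure_subset[of K] in \<open>auto simp: frontier_def\<close>)
  qed
  ultimately have "(\<lambda>n. measure lebesgue (\<Union>(\<A> n))) \<longlonglongrightarrow> measure lebesgue K" by simp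
  then have "(\<lambda>n. vol_radius (\<Union>(\<A> n))) \<longlonglongrightarrow> vol_radius K"
    unfolding vol_radius_def by (rule tendsto_real_root)
  moreover have "\<A> n \<noteq> {}" for n by (simp add: \<A>_def)
  ultimately show thesis using that fam Am by blast
qed

theorem Brunn_Minkowski:
  fixes K L :: "'a::euclidean_space set"
  assumes K: "compact K" "convex K" "interior K \<noteq> {}" and L: "compact L" "convex L" "interior L \<noteq> {}"
  shows "vol_radius K + vol_radius L \<le> vol_radius (K + L)"
proof -
  obtain \<A> :: "nat \<Rightarrow> 'a set set" where A: "\<And>n. box_family (\<A> n)" "\<And>n. \<A> n \<noteq> {}" "\<And>n. \<Union>(\<A> n) \<subseteq> K"
    "(\<lambda>n. vol_radius (\<Union>(\<A> n))) \<longlonglongrightarrow> vol_radius K"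
    using box_family_exhaustion[OF K] by blast
  obtain \<B> :: "nat \<Rightarrow> 'a set set" where B: "\<And>n. box_family (\<B> n)" "\<And>n. \<B> n \<noteq> {}" "\<And>n. \<Union>(\<B> n) \<subseteq> L"
    "(\<lambda>n. vol_radius (\<Union>(\<B> n))) \<longlonglongrightarrow> vol_radius L"
    using box_family_exhaustion[OF L] by blast
  have "vol_radius (\<Union>(\<A> n)) + vol_radius (\<Union>(\<B> n)) \<le> vol_radius (K + L)" for n
  proof -
    have "measure lebesgue (\<Union>(\<A> n) + \<Union>(\<B> n)) \<le> measure lebesgue (K + L)"
      by (intro measure_mono_fmeasurable set_plus_mono2 A B fmeasurableD lmeasurable_compact compact_set_plus
           box_family_compact K L)
    then show ?thesis
      using Brunn_Minkowski_box_family[OF A(1) B(1) A(2) B(2), of n n]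
      by (metis DIM_positive order.trans real_root_le_mono vol_radius_def)
  qed
  then show ?thesis
    using tendsto_add[OF A(4) B(4)] by (intro LIMSEQ_le_const2) auto
qed

section \<open>Cubic forms with concave cube root\<close>

text \<open>For volumes the parameters are the mixed volumes
  \<open>a, b, c = V(A,A,A), V(B,B,B), V(C,C,C)\<close>, \<open>p, q = V(A,A,B), V(A,B,B)\<close>, \<open>r, s = V(A,A,C), V(A,C,C)\<close>,
  \<open>t, u = V(B,B,C), V(B,C,C)\<close> and \<open>m = V(A,B,C)\<close>.\<close>

definition ternary_cubic ::
    "real \<Rightarrow> real \<Rightarrow> real \<Rightarrow> real \<Rightarrow> real \<Rightarrow> real \<Rightarrow> real \<Rightarrow> real \<Rightarrow> real \<Rightarrow> real \<Rightarrow> real \<Rightarrow> real \<Rightarrow> real \<Rightarrow> real" where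
  "ternary_cubic a b c p q r s t u m x y z =
     a * x^3 + b * y^3 + c * z^3 + 3 * p * x\<^sup>2 * y + 3 * q * x * y\<^sup>2 + 3 * r * x\<^sup>2 * z + 3 * s * x * z\<^sup>2
     + 3 * t * y\<^sup>2 * z + 3 * u * y * z\<^sup>2 + 6 * m * x * y * z"

definition root_superadditive :: "(real \<Rightarrow> real \<Rightarrow> real \<Rightarrow> real) \<Rightarrow> bool" where
  "root_superadditive f \<longleftrightarrow> (\<forall>x y z x' y' z'. 0 \<le> x \<and> 0 \<le> y \<and> 0 \<le> z \<and> 0 \<le> x' \<and> 0 \<le> y' \<and> 0 \<le> z' \<longrightarrow>
     root 3 (f x y z) + root 3 (f x' y' z') \<le> root 3 (f (x + x') (y + y') (z + z')))"

lemma root_superadditiveD: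
  "root_superadditive f \<Longrightarrow> 0 \<le> x \<Longrightarrow> 0 \<le> y \<Longrightarrow> 0 \<le> z \<Longrightarrow> 0 \<le> x' \<Longrightarrow> 0 \<le> y' \<Longrightarrow> 0 \<le> z' \<Longrightarrow>
     root 3 (f x y z) + root 3 (f x' y' z') \<le> root 3 (f (x + x') (y + y') (z + z'))"
  unfolding root_superadditive_def by blast

lemma root_superadditive_swap:
  assumes "root_superadditive (ternary_cubic a b c p q r s t u m)"
  shows "root_superadditive (ternary_cubic b a c q p t u r s m)"
    and "root_superadditive (ternary_cubic a c b r s p q u t m)"
proof -
  have "ternary_cubic b a c q p t u r s m x y z = ternary_cubic a b c p q r s t u m y x z" for x y z
    by (simp add: ternary_cubic_def)
  then show "root_superadditive (ternary_cubic b a c q p t u r s m)"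
    using assms unfolding root_superadditive_def by simp
  have "ternary_cubic a c b r s p q u t m x y z = ternary_cubic a b c p q r s t u m x z y" for x y z
    by (simp add: ternary_cubic_def)
  then show "root_superadditive (ternary_cubic a c b r s p q u t m)"
    using assms unfolding root_superadditive_def by simp
qed

lemma root_superadditive_first_order:
  assumes f: "root_superadditive (ternary_cubic a b c p q r s t u m)" and pos: "a > 0" "b > 0"
  shows "p > 0"
proof -
  define \<alpha> \<beta> where "\<alpha> = root 3 a" and "\<beta> = root 3 b"
  have \<alpha>: "\<alpha> > 0" "\<alpha>^3 = a" and \<beta>: "\<beta> > 0" "\<beta>^3 = b" using pos by (simp_all add: \<alpha>_def \<beta>_def)
  have le: "3 * \<alpha>\<^sup>2 * \<beta> + 3 * \<alpha> * \<beta>\<^sup>2 * y \<le> 3 * p + 3 * q * y" if y: "y > 0" for y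
  proof -
    have "root 3 (b * y^3) = \<beta> * y" using y by (simp add: \<beta>_def real_root_mult real_root_power_cancel)
    then have "\<alpha> + \<beta> * y \<le> root 3 (ternary_cubic a b c p q r s t u m 1 y 0)"
      using root_superadditiveD[OF f, of 1 0 0 0 y 0] y by (simp add: ternary_cubic_def \<alpha>_def)
    then have "(\<alpha> + \<beta> * y) ^ 3 \<le> root 3 (ternary_cubic a b c p q r s t u m 1 y 0) ^ 3"
      using \<alpha> \<beta> y by (intro power_mono) auto
    then have "(\<alpha> + \<beta> * y) ^ 3 \<le> a + b * y^3 + 3 * p * y + 3 * q * y\<^sup>2"
      by (simp add: ternary_cubic_def odd_real_root_pow)
    then have "y * (3 * \<alpha>\<^sup>2 * \<beta> + 3 * \<alpha> * \<beta>\<^sup>2 * y) \<le> y * (3 * p + 3 * q * y)"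
      unfolding \<alpha>(2)[symmetric] \<beta>(2)[symmetric] by (simp add: power2_eq_square power3_eq_cube algebra_simps)
    then show ?thesis using y by simp
  qed
  have "3 * \<alpha>\<^sup>2 * \<beta> \<le> 3 * p"
  proof (rule tendsto_le[OF trivial_limit_at_right_real])
    show "((\<lambda>y. 3 * p + 3 * q * y) \<longlongrightarrow> 3 * p) (at_right 0)"
      by (auto intro!: tendsto_eq_intros)
    show "((\<lambda>y. 3 * \<alpha>\<^sup>2 * \<beta> + 3 * \<alpha> * \<beta>\<^sup>2 * y) \<longlongrightarrow> 3 * \<alpha>\<^sup>2 * \<beta>) (at_right 0)"
      by (auto intro!: tendsto_eq_intros)
    show "\<forall>\<^sub>F y in at_right 0. 3 * \<alpha>\<^sup>2 * \<beta> + 3 * \<alpha> * \<beta>\<^sup>2 * y \<le> 3 * p + 3 * q * y"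
      using le by (auto simp: eventually_at_filter)
  qed
  moreover have "\<alpha>\<^sup>2 * \<beta> > 0" using \<alpha> \<beta> by simp
  ultimately show ?thesis by linarith
qed

lemma cube_root_midpoint_second_order:
  fixes g0 \<alpha> \<beta> \<gamma> \<delta> :: real
  assumes g0: "g0 > 0" and \<delta>: "\<delta> > 0"
    and mid: "\<And>\<tau>. 0 < \<tau> \<Longrightarrow> \<tau> < \<delta> \<Longrightarrow>
      root 3 (g0 + \<alpha> * \<tau> + \<beta> * \<tau>\<^sup>2 + \<gamma> * \<tau>^3) + root 3 (g0 - \<alpha> * \<tau> + \<beta> * \<tau>\<^sup>2 - \<gamma> * \<tau>^3) \<le> 2 * root 3 g0"
  shows "3 * g0 * \<beta> \<le> \<alpha>\<^sup>2"
proof (rule ccontr)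
  assume neg: "\<not> ?thesis"
  define k where "k = root 3 g0"
  have k: "k > 0" "k^3 = g0" using g0 by (simp_all add: k_def)
  define s where "s = \<alpha> / (3 * k\<^sup>2)"
  have \<alpha>: "\<alpha> = 3 * k\<^sup>2 * s" using k by (simp add: s_def)
  define \<eta> where "\<eta> = \<beta> - 3 * k * s\<^sup>2"
  have "k^3 * (3 * \<eta>) = 3 * g0 * \<beta> - \<alpha>\<^sup>2"
    unfolding \<eta>_def \<alpha> k(2)[symmetric] by (simp add: power2_eq_square power3_eq_cube algebra_simps)
  then have \<eta>: "\<eta> > 0" using neg k by (smt (verit) zero_less_mult_pos zero_less_power)
  define \<kappa> where "\<kappa> = \<eta> / (6 * k\<^sup>2)"
  have \<kappa>: "\<kappa> > 0" "6 * k\<^sup>2 * \<kappa> = \<eta>" using \<eta> k by (simp_all add: \<kappa>_def)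
  define R where "R \<tau> = \<eta> / 2 + \<tau> * (\<gamma> - s^3 - 6 * k * s * \<kappa> - (3 * k * \<kappa>\<^sup>2 + 3 * s\<^sup>2 * \<kappa>) * \<tau> - 3 * s * \<kappa>\<^sup>2 * \<tau>\<^sup>2 - \<kappa>^3 * \<tau>^3)" for \<tau>
  have expand: "g0 + \<alpha> * \<tau> + \<beta> * \<tau>\<^sup>2 + \<gamma> * \<tau>^3 - (k + s * \<tau> + \<kappa> * \<tau>\<^sup>2)^3 = \<tau>\<^sup>2 * R \<tau>" for \<tau>
  proof -
    have \<beta>: "\<beta> = \<eta> / 2 + 3 * k\<^sup>2 * \<kappa> + 3 * k * s\<^sup>2" using \<kappa>(2) \<eta>_def by linarith
    show ?thesis unfolding R_def \<alpha> k(2)[symmetric] \<beta>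
      by (simp add: power2_eq_square power3_eq_cube algebra_simps)
  qed
  have low: "k + s * \<tau> + \<kappa> * \<tau>\<^sup>2 \<le> root 3 (g0 + \<alpha> * \<tau> + \<beta> * \<tau>\<^sup>2 + \<gamma> * \<tau>^3)" if "R \<tau> \<ge> 0" for \<tau>
  proof -
    have "\<tau>\<^sup>2 * R \<tau> \<ge> 0" using that by simp
    then have "(k + s * \<tau> + \<kappa> * \<tau>\<^sup>2)^3 \<le> g0 + \<alpha> * \<tau> + \<beta> * \<tau>\<^sup>2 + \<gamma> * \<tau>^3" using expand[of \<tau>] by linarith
    then have "root 3 ((k + s * \<tau> + \<kappa> * \<tau>\<^sup>2)^3) \<le> root 3 (g0 + \<alpha> * \<tau> + \<beta> * \<tau>\<^sup>2 + \<gamma> * \<tau>^3)"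
      by simp
    then show ?thesis by (simp add: odd_real_root_power_cancel)
  qed
  have "isCont R 0" unfolding R_def by (intro continuous_intros)
  moreover have "R 0 > 0" using \<eta> by (simp add: R_def)
  ultimately have "\<forall>\<^sub>F \<tau> in nhds 0. R \<tau> > 0"
    unfolding isCont_def tendsto_at_iff_tendsto_nhds by (rule order_tendstoD)
  then obtain d where d: "d > 0" "\<And>\<tau>. dist \<tau> 0 < d \<Longrightarrow> R \<tau> > 0"
    unfolding eventually_nhds_metric by blast
  define \<tau> where "\<tau> = min d \<delta> / 2"
  have \<tau>: "0 < \<tau>" "\<tau> < d" "\<tau> < \<delta>" using d \<delta> by (auto simp: \<tau>_def min_def)
  have "R \<tau> \<ge> 0" "R (-\<tau>) \<ge> 0" using d(2)[of \<tau>] d(2)[of "-\<tau>"] \<tau> by (auto intro: less_imp_le)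
  from low[OF this(1)] low[OF this(2)] mid[OF \<tau>(1,3)] have "2 * \<kappa> * \<tau>\<^sup>2 \<le> 0"
    by (simp add: k_def)
  moreover have "\<kappa> * \<tau>\<^sup>2 > 0" using \<kappa> \<tau> by simp
  ultimately show False by linarith
qed

lemma root_superadditive_second_order:
  assumes f: "root_superadditive (ternary_cubic a b c p q r s t u m)" and pos: "a > 0" "b > 0" "c > 0"
    and nonneg: "p \<ge> 0" "q \<ge> 0" "r \<ge> 0" "s \<ge> 0" "t \<ge> 0" "u \<ge> 0"
  shows "a * (q * y\<^sup>2 + 2 * m * y * z + s * z\<^sup>2) \<le> (p * y + r * z)\<^sup>2"
proof -
  let ?f = "ternary_cubic a b c p q r s t u m"
  define g0 where "g0 \<epsilon> = ?f 1 \<epsilon> \<epsilon>" for \<epsilon>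
  define \<alpha> where "\<alpha> \<epsilon> = 3 * (p * y + r * z) + 6 * (q * y + s * z + m * (y + z)) * \<epsilon> + 3 * (b * y + c * z + t * (2 * y + z) + u * (y + 2 * z)) * \<epsilon>\<^sup>2" for \<epsilon>
  define \<beta> where "\<beta> \<epsilon> = 3 * (q * y\<^sup>2 + 2 * m * y * z + s * z\<^sup>2) + 3 * (b * y\<^sup>2 + c * z\<^sup>2 + t * (y\<^sup>2 + 2 * y * z) + u * (z\<^sup>2 + 2 * y * z)) * \<epsilon>" for \<epsilon>
  define \<gamma> where "\<gamma> = b * y^3 + c * z^3 + 3 * t * y\<^sup>2 * z + 3 * u * y * z\<^sup>2"
  have expand: "?f 1 (\<epsilon> + \<tau> * y) (\<epsilon> + \<tau> * z) = g0 \<epsilon> + \<alpha> \<epsilon> * \<tau> + \<beta> \<epsilon> * \<tau>\<^sup>2 + \<gamma> * \<tau>^3" for \<epsilon> \<tau>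
    by (simp add: g0_def \<alpha>_def \<beta>_def \<gamma>_def ternary_cubic_def power2_eq_square power3_eq_cube algebra_simps)
  have g0: "(g0 \<longlongrightarrow> a) (at_right 0)"
    unfolding g0_def ternary_cubic_def by (auto intro!: tendsto_eq_intros)
  have ev: "\<forall>\<^sub>F \<epsilon> in at_right 0. 3 * g0 \<epsilon> * \<beta> \<epsilon> \<le> (\<alpha> \<epsilon>)\<^sup>2"
  proof -
    have "\<forall>\<^sub>F \<epsilon> in at_right 0. g0 \<epsilon> > 0" using order_tendstoD(1)[OF g0 pos(1)] .
    moreover have "\<forall>\<^sub>F \<epsilon> in at_right (0::real). \<epsilon> > 0" by (simp add: eventually_at_right_less)
    ultimately show ?thesis
    proof eventually_elim
      case (elim \<epsilon>)
      define \<delta> where "\<delta> = \<epsilon> / (\<bar>y\<bar> + \<bar>z\<bar> + 1)"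
      have \<delta>: "\<delta> > 0" using elim by (simp add: \<delta>_def add_nonneg_pos)
      show ?case
      proof (rule cube_root_midpoint_second_order[OF elim(1) \<delta>])
        fix \<tau> assume \<tau>: "0 < \<tau>" "\<tau> < \<delta>"
        have "\<tau> * (\<bar>y\<bar> + \<bar>z\<bar> + 1) < \<epsilon>" using \<tau> by (simp add: \<delta>_def pos_less_divide_eq add_nonneg_pos)
        moreover have "\<tau> * \<bar>y\<bar> \<le> \<tau> * (\<bar>y\<bar> + \<bar>z\<bar> + 1)" "\<tau> * \<bar>z\<bar> \<le> \<tau> * (\<bar>y\<bar> + \<bar>z\<bar> + 1)" using \<tau> by auto
        moreover have "\<bar>\<tau> * y\<bar> = \<tau> * \<bar>y\<bar>" "\<bar>\<tau> * z\<bar> = \<tau> * \<bar>z\<bar>" using \<tau> by (simp_all add: abs_mult)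
        ultimately have "\<bar>\<tau> * y\<bar> \<le> \<epsilon>" "\<bar>\<tau> * z\<bar> \<le> \<epsilon>" by linarith+
        then have nn: "0 \<le> \<epsilon> + \<tau> * y" "0 \<le> \<epsilon> + \<tau> * z" "0 \<le> \<epsilon> + (-\<tau>) * y" "0 \<le> \<epsilon> + (-\<tau>) * z"
          by (simp_all add: abs_le_iff)
        have "root 3 (?f 1 (\<epsilon> + \<tau> * y) (\<epsilon> + \<tau> * z)) + root 3 (?f 1 (\<epsilon> + (-\<tau>) * y) (\<epsilon> + (-\<tau>) * z))
            \<le> root 3 (?f 2 (2 * \<epsilon>) (2 * \<epsilon>))"
          using root_superadditiveD[OF f zero_le_one nn(1,2) zero_le_one nn(3,4)] by (simp add: mult_2 algebra_simps)
        also have "?f 2 (2 * \<epsilon>) (2 * \<epsilon>) = 2^3 * g0 \<epsilon>"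
          by (simp add: g0_def ternary_cubic_def power2_eq_square power3_eq_cube algebra_simps)
        also have "root 3 (2^3 * g0 \<epsilon>) = 2 * root 3 (g0 \<epsilon>)"
          unfolding real_root_mult by (subst real_root_power_cancel) simp_all
        finally show "root 3 (g0 \<epsilon> + \<alpha> \<epsilon> * \<tau> + \<beta> \<epsilon> * \<tau>\<^sup>2 + \<gamma> * \<tau>^3)
            + root 3 (g0 \<epsilon> - \<alpha> \<epsilon> * \<tau> + \<beta> \<epsilon> * \<tau>\<^sup>2 - \<gamma> * \<tau>^3) \<le> 2 * root 3 (g0 \<epsilon>)"
          unfolding expand by simp
      qed
    qed
  qed
  have "3 * a * (3 * (q * y\<^sup>2 + 2 * m * y * z + s * z\<^sup>2)) \<le> (3 * (p * y + r * z))\<^sup>2"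
  proof (rule tendsto_le[OF trivial_limit_at_right_real _ _ ev])
    show "((\<lambda>\<epsilon>. 3 * g0 \<epsilon> * \<beta> \<epsilon>) \<longlongrightarrow> 3 * a * (3 * (q * y\<^sup>2 + 2 * m * y * z + s * z\<^sup>2))) (at_right 0)"
      unfolding \<beta>_def by (intro tendsto_mult tendsto_const g0) (auto intro!: tendsto_eq_intros)
    show "((\<lambda>\<epsilon>. (\<alpha> \<epsilon>)\<^sup>2) \<longlongrightarrow> (3 * (p * y + r * z))\<^sup>2) (at_right 0)"
      unfolding \<alpha>_def by (auto intro!: tendsto_eq_intros)
  qed
  then have "9 * (a * (q * y\<^sup>2 + 2 * m * y * z + s * z\<^sup>2)) \<le> 9 * (p * y + r * z)\<^sup>2"
    by (simp add: power2_eq_square algebra_simps)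
  then show ?thesis by simp
qed

lemma psd_discriminant:
  fixes P Q R :: real
  assumes "\<And>y z. P * y\<^sup>2 + 2 * Q * y * z + R * z\<^sup>2 \<ge> 0"
  shows "Q\<^sup>2 \<le> P * R" "P \<ge> 0" "R \<ge> 0"
proof -
  show PR: "P \<ge> 0" "R \<ge> 0" using assms[of 1 0] assms[of 0 1] by simp_all
  show "Q\<^sup>2 \<le> P * R"
  proof (cases "P = 0")
    case True
    have "Q = 0"
    proof (rule ccontr)
      assume "Q \<noteq> 0"
      then show False using assms[of "-(R + 1) / (2 * Q)" 1] True by simp
    qed
    then show ?thesis using True by simp
  next
    case False
    then have "P > 0" using PR by simp
    have "P * (P * R - Q\<^sup>2) = P * Q\<^sup>2 + 2 * Q * (-Q) * P + R * P\<^sup>2"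
      by (simp add: power2_eq_square algebra_simps)
    also have "\<dots> \<ge> 0" using assms[of "-Q" P] by simp
    finally show ?thesis using \<open>P > 0\<close> by (simp add: zero_le_mult_iff)
  qed
qed

lemma lorentzian_discriminant:
  assumes "root_superadditive (ternary_cubic a b c p q r s t u m)" "a > 0" "b > 0" "c > 0"
    and "p \<ge> 0" "q \<ge> 0" "r \<ge> 0" "s \<ge> 0" "t \<ge> 0" "u \<ge> 0"
  shows "(p * r - a * m)\<^sup>2 \<le> (p\<^sup>2 - a * q) * (r\<^sup>2 - a * s)" "p\<^sup>2 - a * q \<ge> 0" "r\<^sup>2 - a * s \<ge> 0"
proof -
  have "(p\<^sup>2 - a * q) * y\<^sup>2 + 2 * (p * r - a * m) * y * z + (r\<^sup>2 - a * s) * z\<^sup>2 \<ge> 0" for y z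
    using root_superadditive_second_order[OF assms, of y z] by (simp add: power2_eq_square algebra_simps)
  from psd_discriminant[OF this] show "(p * r - a * m)\<^sup>2 \<le> (p\<^sup>2 - a * q) * (r\<^sup>2 - a * s)"
    "p\<^sup>2 - a * q \<ge> 0" "r\<^sup>2 - a * s \<ge> 0" by blast+
qed

lemma mixed_coefficient_bounds:
  assumes f: "root_superadditive (ternary_cubic a b c p q r s t u m)" and pos: "a > 0" "b > 0" "c > 0"
  shows "p > 0" "q > 0" "r > 0" "s > 0" "t > 0" "u > 0" "a * m \<le> 2 * p * r" "a * t \<le> 4 * q * r"
proof -
  note g = root_superadditive_swap[OF f]
  show p: "p > 0" using root_superadditive_first_order[OF f] pos by blast
  show q: "q > 0" using root_superadditive_first_order[OF g(1)] pos by blast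
  show r: "r > 0" using root_superadditive_first_order[OF g(2)] pos by blast
  show t: "t > 0" using root_superadditive_first_order[OF root_superadditive_swap(2)[OF g(1)]] pos by blast
  show s: "s > 0" using root_superadditive_first_order[OF root_superadditive_swap(1)[OF g(2)]] pos by blast
  show u: "u > 0"
    using root_superadditive_first_order[OF root_superadditive_swap(2)[OF root_superadditive_swap(1)[OF g(2)]]] pos by blast
  note nn = less_imp_le[OF p] less_imp_le[OF q] less_imp_le[OF r] less_imp_le[OF s] less_imp_le[OF t] less_imp_le[OF u]
  have "(p * r - a * m)\<^sup>2 \<le> (p\<^sup>2 - a * q) * (r\<^sup>2 - a * s)"
    by (rule lorentzian_discriminant[OF f pos nn])
  also have "(p\<^sup>2 - a * q) * (r\<^sup>2 - a * s) \<le> p\<^sup>2 * r\<^sup>2"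
    using lorentzian_discriminant(2,3)[OF f pos nn] pos q s by (intro mult_mono) auto
  also have "p\<^sup>2 * r\<^sup>2 = (p * r)\<^sup>2" by (simp add: power_mult_distrib)
  finally have "\<bar>p * r - a * m\<bar> \<le> \<bar>p * r\<bar>" by (simp add: abs_le_square_iff)
  then show am: "a * m \<le> 2 * p * r" using p r by (simp add: abs_le_iff)
  have L: "(q * t - b * m)\<^sup>2 \<le> (q\<^sup>2 - b * p) * (t\<^sup>2 - b * u)" "q\<^sup>2 - b * p \<ge> 0"
    using lorentzian_discriminant[OF g(1) pos(2,1,3) nn(2,1,5,6,3,4)] by blast+
  have "(q\<^sup>2 - b * p) * (t\<^sup>2 - b * u) \<le> (q\<^sup>2 - b * p) * t\<^sup>2"
    using L(2) pos u by (intro mult_left_mono) auto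
  with L(1) have "(q * t - b * m)\<^sup>2 \<le> (q\<^sup>2 - b * p) * t\<^sup>2" by linarith
  then have "b * (p * t\<^sup>2 + b * m\<^sup>2) \<le> b * (2 * q * t * m)"
    by (simp add: power2_eq_square algebra_simps)
  then have "p * t\<^sup>2 + b * m\<^sup>2 \<le> 2 * q * t * m" using pos by simp
  moreover have "b * m\<^sup>2 \<ge> 0" using pos by simp
  ultimately have "t * (p * t) \<le> t * (2 * q * m)" by (simp add: power2_eq_square algebra_simps)
  then have "p * t \<le> 2 * q * m" using t by simp
  then have "a * (p * t) \<le> a * (2 * q * m)" using pos by simp
  also have "\<dots> = 2 * q * (a * m)" by simp
  also have "\<dots> \<le> 2 * q * (2 * p * r)" using am q by (intro mult_left_mono) auto
  finally have "p * (a * t) \<le> p * (4 * q * r)" by (simp add: algebra_simps)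
  then show "a * t \<le> 4 * q * r" using p by simp
qed

lemma cubic_submultiplicative:
  assumes f: "root_superadditive (ternary_cubic a b c p q r s t u m)" and pos: "a > 0" "b > 0" "c > 0"
  defines "F \<equiv> ternary_cubic a b c p q r s t u m"
  shows "F 1 0 0 * F 1 1 1 \<le> 4/3 * F 1 1 0 * F 1 0 1"
proof -
  note B = mixed_coefficient_bounds[OF f pos]
  have au: "a * u \<le> 4 * s * p" using mixed_coefficient_bounds(8)[OF root_superadditive_swap(2)[OF f] pos(1,3,2)] .
  have "F 1 0 0 * F 1 1 1 = a * (a + 3 * p + 3 * q + b) + a * (3 * r + 3 * s + c) + 6 * (a * m) + 3 * (a * t) + 3 * (a * u)"
    by (simp add: F_def ternary_cubic_def algebra_simps)
  also have "\<dots> \<le> a * (a + 3 * p + 3 * q + b) + a * (3 * r + 3 * s + c) + 6 * (2 * p * r) + 3 * (4 * q * r) + 3 * (4 * s * p)"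
    using B(7,8) au by linarith
  also have "\<dots> \<le> 4/3 * (a + 3 * p + 3 * q + b) * (a + 3 * r + 3 * s + c)"
  proof -
    have "0 \<le> a * (a + 3 * p + 3 * q + b) + a * (3 * r + 3 * s + c) + 4 * b * (3 * r + 3 * s + c) + 12 * (p + q) * c + 36 * q * s"
      using B pos by (intro add_nonneg_nonneg mult_nonneg_nonneg) auto
    then show ?thesis by (simp add: algebra_simps)
  qed
  finally show ?thesis by (simp add: F_def ternary_cubic_def algebra_simps)
qed

section \<open>The inequality with constant 4/3\<close>

lemma vol_scaleR: "vol ((*\<^sub>R) x ` S) = \<bar>x\<bar> ^ DIM('a) * vol (S :: 'a::euclidean_space set)"
  using measure_lebesgue_affine[of x 0 S] by (simp add: vol_def image_def)

lemma vol_translate: "vol ({a} + S) = vol (S :: 'a::euclidean_space set)"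
proof -
  have "{a} + S = (+) a ` S" by (auto simp: set_plus_def)
  then show ?thesis by (simp add: vol_def measure_translation)
qed

lemma vol_mono:
  fixes S T :: "'a::euclidean_space set"
  shows "S \<subseteq> T \<Longrightarrow> compact S \<Longrightarrow> compact T \<Longrightarrow> vol S \<le> vol T"
  unfolding vol_def by (intro measure_mono_fmeasurable) (auto intro: fmeasurableD lmeasurable_compact)

lemma vol_nonneg [simp]: "vol S \<ge> 0"
  by (simp add: vol_def)

lemma vol_le_plus:
  fixes A B :: "'a::euclidean_space set"
  assumes "compact A" "compact B" "B \<noteq> {}"
  shows "vol A \<le> vol (A + B)"
proof -
  obtain b where b: "b \<in> B" using assms by blast
  have "vol A = vol ({b} + A)" by (simp add: vol_translate)
  also have "\<dots> \<le> vol (A + B)"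
    unfolding add.commute[of "{b}"] using b assms
    by (intro vol_mono set_plus_mono2 compact_set_plus) auto
  finally show ?thesis .
qed

lemma vol_pos_iff_interior:
  fixes K :: "'a::euclidean_space set"
  assumes "compact K" "convex K"
  shows "vol K > 0 \<longleftrightarrow> interior K \<noteq> {}"
proof -
  have "vol K > 0 \<longleftrightarrow> \<not> negligible K"
    using negligible_iff_measure0[OF lmeasurable_compact[OF assms(1)]]
    by (simp add: vol_def less_le)
  also have "\<dots> \<longleftrightarrow> interior K \<noteq> {}"
    using negligible_convex_interior[OF assms(2)] by simp
  finally show ?thesis .
qed

lemma convex_scaleR_add:
  fixes A :: "'a::real_vector set"
  assumes "convex A" "x \<ge> 0" "y \<ge> 0"
  shows "(*\<^sub>R) (x + y) ` A = (*\<^sub>R) x ` A + (*\<^sub>R) y ` A"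
proof (intro equalityI subsetI)
  fix k assume "k \<in> (*\<^sub>R) (x + y) ` A"
  then show "k \<in> (*\<^sub>R) x ` A + (*\<^sub>R) y ` A" by (auto simp: scaleR_add_left)
next
  fix k assume "k \<in> (*\<^sub>R) x ` A + (*\<^sub>R) y ` A"
  then obtain a b where k: "k = x *\<^sub>R a + y *\<^sub>R b" "a \<in> A" "b \<in> A"
    by (elim set_plus_elim imageE) blast
  show "k \<in> (*\<^sub>R) (x + y) ` A"
  proof (cases "x + y = 0")
    case True
    then have "x = 0" "y = 0" using assms by auto
    then show ?thesis using k by auto
  next
    case False
    then have pos: "x + y > 0" using assms by simp
    have "(x / (x + y)) *\<^sub>R a + (y / (x + y)) *\<^sub>R b \<in> A"
      using assms k pos by (intro convexD) (auto simp: add_divide_distrib[symmetric])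
    moreover have "k = (x + y) *\<^sub>R ((x / (x + y)) *\<^sub>R a + (y / (x + y)) *\<^sub>R b)"
      using pos by (simp add: k scaleR_add_right)
    ultimately show ?thesis by blast
  qed
qed

lemma comb3_add:
  assumes "convex A" "convex B" "convex C" "x \<ge> 0" "y \<ge> 0" "z \<ge> 0" "x' \<ge> 0" "y' \<ge> 0" "z' \<ge> 0"
  shows "comb3 A B C (x + x') (y + y') (z + z') = comb3 A B C x y z + comb3 A B C x' y' z'"
  using assms by (simp add: comb3_def convex_scaleR_add add_ac)

lemma image_zero_eq_zero: "A \<noteq> {} \<Longrightarrow> (\<lambda>x. 0) ` A = (0 :: 'a::zero set)"
  by (auto simp: set_zero)

lemma comb3_interior:
  fixes A B C :: "'a::euclidean_space set"
  assumes A: "compact A" "convex A" "vol A > 0" and B: "compact B" "convex B" "vol B > 0"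
    and C: "compact C" "convex C" "vol C > 0"
    and nn: "x \<ge> 0" "y \<ge> 0" "z \<ge> 0" "x + y + z > 0"
  shows "vol (comb3 A B C x y z) > 0"
proof -
  have ne: "A \<noteq> {}" "B \<noteq> {}" "C \<noteq> {}" using assms by (auto simp: vol_def)
  have comp: "compact ((*\<^sub>R) x ` A)" "compact ((*\<^sub>R) y ` B)" "compact ((*\<^sub>R) z ` C)"
    using A B C by (auto intro: compact_scaling)
  have "vol ((*\<^sub>R) x ` A) \<le> vol (comb3 A B C x y z)"
    unfolding comb3_def add.assoc using comp ne by (intro vol_le_plus compact_set_plus) (auto simp: set_plus_def)
  moreover have "vol ((*\<^sub>R) y ` B) \<le> vol ((*\<^sub>R) y ` B + ((*\<^sub>R) x ` A + (*\<^sub>R) z ` C))"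
    using comp ne by (intro vol_le_plus compact_set_plus) (auto simp: set_plus_def)
  moreover have "vol ((*\<^sub>R) z ` C) \<le> vol ((*\<^sub>R) z ` C + ((*\<^sub>R) x ` A + (*\<^sub>R) y ` B))"
    using comp ne by (intro vol_le_plus compact_set_plus) (auto simp: set_plus_def)
  moreover have "(*\<^sub>R) y ` B + ((*\<^sub>R) x ` A + (*\<^sub>R) z ` C) = comb3 A B C x y z"
    "(*\<^sub>R) z ` C + ((*\<^sub>R) x ` A + (*\<^sub>R) y ` B) = comb3 A B C x y z"
    by (simp_all add: comb3_def add_ac)
  moreover have "x > 0 \<or> y > 0 \<or> z > 0" using nn by linarith
  moreover have "vol ((*\<^sub>R) x ` A) > 0" if "x > 0" using that A by (simp add: vol_scaleR)
  moreover have "vol ((*\<^sub>R) y ` B) > 0" if "y > 0" using that B by (simp add: vol_scaleR)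
  moreover have "vol ((*\<^sub>R) z ` C) > 0" if "z > 0" using that C by (simp add: vol_scaleR)
  ultimately show ?thesis by force
qed

lemma volume_ternary_cubic:
  fixes A B C :: "(real^3) set"
  assumes A: "compact A" "convex A" "vol A > 0" and B: "compact B" "convex B" "vol B > 0"
    and C: "compact C" "convex C" "vol C > 0"
  obtains p q r s t u m where
    "\<And>x y z. x \<ge> 0 \<Longrightarrow> y \<ge> 0 \<Longrightarrow> z \<ge> 0 \<Longrightarrow>
       vol (comb3 A B C x y z) = ternary_cubic (vol A) (vol B) (vol C) p q r s t u m x y z"
    "root_superadditive (ternary_cubic (vol A) (vol B) (vol C) p q r s t u m)"
proof -
  define f where "f x y z = vol (comb3 A B C x y z)" for x y z
  have ne: "A \<noteq> {}" "B \<noteq> {}" "C \<noteq> {}" using assms by (auto simp: vol_def)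
  have int: "interior A \<noteq> {}" "interior B \<noteq> {}" "interior C \<noteq> {}"
    using vol_pos_iff_interior A B C by blast+
  have base: "f 1 0 0 = vol A" "f 0 1 0 = vol B" "f 0 0 1 = vol C"
    using ne by (simp_all add: f_def comb3_def image_zero_eq_zero)
  have cubic: "f x y z = interp_cubic f x y z" if "x \<ge> 0" "y \<ge> 0" "z \<ge> 0" for x y z
    unfolding f_def vol_def using convex_volume_cubic[OF A(1,2) int(1) B(1,2) int(2) C(1,2) int(3) that] .
  define p where "p = (f 2 1 0 - 2 * f 1 1 0 - 6 * f 1 0 0 + f 0 1 0) / 6"
  define q where "q = (f 1 2 0 - 2 * f 1 1 0 - 6 * f 0 1 0 + f 1 0 0) / 6"
  define r where "r = (f 2 0 1 - 2 * f 1 0 1 - 6 * f 1 0 0 + f 0 0 1) / 6"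
  define s where "s = (f 1 0 2 - 2 * f 1 0 1 - 6 * f 0 0 1 + f 1 0 0) / 6"
  define t where "t = (f 0 2 1 - 2 * f 0 1 1 - 6 * f 0 1 0 + f 0 0 1) / 6"
  define u where "u = (f 0 1 2 - 2 * f 0 1 1 - 6 * f 0 0 1 + f 0 1 0) / 6"
  define m where "m = (f 1 1 1 - f 1 1 0 - f 1 0 1 - f 0 1 1 + f 1 0 0 + f 0 1 0 + f 0 0 1) / 6"
  have tern: "f x y z = ternary_cubic (vol A) (vol B) (vol C) p q r s t u m x y z"
    if "x \<ge> 0" "y \<ge> 0" "z \<ge> 0" for x y z
    unfolding cubic[OF that] interp_cubic_def ternary_cubic_def p_def q_def r_def s_def t_def u_def m_def base
    by (simp add: field_simps)
  have f0: "f 0 0 0 = 0" using tern[of 0 0 0] by (simp add: ternary_cubic_def)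
  have "root_superadditive (ternary_cubic (vol A) (vol B) (vol C) p q r s t u m)"
    unfolding root_superadditive_def
  proof (intro allI impI, elim conjE)
    fix x y z x' y' z' :: real
    assume nn: "0 \<le> x" "0 \<le> y" "0 \<le> z" "0 \<le> x'" "0 \<le> y'" "0 \<le> z'"
    have "root 3 (f x y z) + root 3 (f x' y' z') \<le> root 3 (f (x + x') (y + y') (z + z'))"
    proof (cases "x + y + z > 0 \<and> x' + y' + z' > 0")
      case True
      then have "vol (comb3 A B C x y z) > 0" "vol (comb3 A B C x' y' z') > 0"
        using comb3_interior[OF A B C] nn by blast+
      moreover have comp: "compact (comb3 A B C x y z)" "convex (comb3 A B C x y z)" for x y z
        by (intro compact_comb3 convex_comb3 A B C)+
      ultimately have "vol_radius (comb3 A B C x y z) + vol_radius (comb3 A B C x' y' z')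
          \<le> vol_radius (comb3 A B C x y z + comb3 A B C x' y' z')"
        using vol_pos_iff_interior[OF comp] by (intro Brunn_Minkowski comp) auto
      then show ?thesis
        by (simp add: comb3_add[OF A(2) B(2) C(2) nn] f_def vol_def vol_radius_def)
    next
      case False
      then have "(x = 0 \<and> y = 0 \<and> z = 0) \<or> (x' = 0 \<and> y' = 0 \<and> z' = 0)" using nn by linarith
      then show ?thesis using f0 by auto
    qed
    then show "root 3 (ternary_cubic (vol A) (vol B) (vol C) p q r s t u m x y z)
      + root 3 (ternary_cubic (vol A) (vol B) (vol C) p q r s t u m x' y' z')
      \<le> root 3 (ternary_cubic (vol A) (vol B) (vol C) p q r s t u m (x + x') (y + y') (z + z'))"
      using tern nn by simp
  qed
  then show thesis using that tern unfolding f_def by blast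
qed

lemma set_plus_eq_comb3:
  fixes A B C :: "'a::real_vector set"
  assumes "B \<noteq> {}" "C \<noteq> {}"
  shows "A + B + C = comb3 A B C 1 1 1" "A + B = comb3 A B C 1 1 0" "A + C = comb3 A B C 1 0 1"
  using assms by (simp_all add: comb3_def image_zero_eq_zero)

definition vol_submult_on :: "real \<Rightarrow> 'a::euclidean_space set \<Rightarrow> bool" where
  "vol_submult_on k A \<longleftrightarrow> (\<forall>B C. compact B \<and> convex B \<and> compact C \<and> convex C \<longrightarrow>
     vol A * vol (A + B + C) \<le> k * vol (A + B) * vol (A + C))"

lemma vol_enlarge_le:
  fixes A B :: "'a::euclidean_space set"
  assumes A: "compact A" "convex A" and B: "compact B" "convex B" "0 \<in> B" and e: "e \<ge> 0"
  shows "vol (A + (B + (*\<^sub>R) e ` A)) \<le> (1 + e) ^ DIM('a) * vol (A + B)"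
proof -
  have "A + (B + (*\<^sub>R) e ` A) = (*\<^sub>R) 1 ` A + (*\<^sub>R) e ` A + B" by (simp add: add_ac)
  also have "\<dots> = (*\<^sub>R) (1 + e) ` A + B" using A e by (simp add: convex_scaleR_add)
  also have "\<dots> \<subseteq> (*\<^sub>R) (1 + e) ` A + (*\<^sub>R) (1 + e) ` B"
  proof (intro set_plus_mono2 order.refl subsetI)
    fix b assume b: "b \<in> B"
    have "(1 / (1 + e)) *\<^sub>R b + (e / (1 + e)) *\<^sub>R 0 \<in> B"
      using B b e by (intro convexD) (auto simp: add_divide_distrib[symmetric])
    then have "(1 / (1 + e)) *\<^sub>R b \<in> B" by simp
    moreover have "b = (1 + e) *\<^sub>R ((1 / (1 + e)) *\<^sub>R b)" using e by simp
    ultimately show "b \<in> (*\<^sub>R) (1 + e) ` B" by blast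
  qed
  also have "\<dots> = (*\<^sub>R) (1 + e) ` (A + B)"
    by (force simp: set_plus_def scaleR_add_right image_iff)
  finally have "vol (A + (B + (*\<^sub>R) e ` A)) \<le> vol ((*\<^sub>R) (1 + e) ` (A + B))"
    using A B by (intro vol_mono compact_set_plus compact_scaling) auto
  then show ?thesis using e by (simp add: vol_scaleR)
qed

lemma vol_submult_of_positive:
  fixes A :: "'a::euclidean_space set"
  assumes A: "compact A" "convex A" and k: "k \<ge> 0"
    and pos: "\<And>B C. vol A > 0 \<Longrightarrow> compact B \<Longrightarrow> convex B \<Longrightarrow> vol B > 0 \<Longrightarrow> compact C \<Longrightarrow> convex C \<Longrightarrow> vol C > 0 \<Longrightarrow>
      vol A * vol (A + B + C) \<le> k * vol (A + B) * vol (A + C)"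
  shows "vol_submult_on k A"
  unfolding vol_submult_on_def
proof (intro allI impI, elim conjE)
  fix B' C' :: "'a set"
  assume B': "compact B'" "convex B'" and C': "compact C'" "convex C'"
  show "vol A * vol (A + B' + C') \<le> k * vol (A + B') * vol (A + C')"
  proof (cases "vol A = 0 \<or> B' = {} \<or> C' = {}")
    case True
    then show ?thesis using k by (auto simp: vol_def)
  next
    case False
    then have vA: "vol A > 0" and ne: "B' \<noteq> {}" "C' \<noteq> {}" by (auto simp: less_le)
    obtain b c where bc: "b \<in> B'" "c \<in> C'" using ne by blast
    define B C where "B = {-b} + B'" and "C = {-c} + C'"
    have B: "compact B" "convex B" and C: "compact C" "convex C"
      unfolding B_def C_def by (intro compact_set_plus convex_set_plus B' C' compact_sing convex_singleton)+
    have "-b + b \<in> B" "-c + c \<in> C" unfolding B_def C_def by (intro set_plus_intro bc singletonI)+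
    then have 0: "0 \<in> B" "0 \<in> C" by simp_all
    have trans: "vol (A + B) = vol (A + B')" "vol (A + C) = vol (A + C')" "vol (A + B + C) = vol (A + B' + C')"
    proof -
      have "A + B = {-b} + (A + B')" "A + C = {-c} + (A + C')" "A + B + C = {-b} + ({-c} + (A + B' + C'))"
        by (simp_all add: B_def C_def add_ac)
      then show "vol (A + B) = vol (A + B')" "vol (A + C) = vol (A + C')" "vol (A + B + C) = vol (A + B' + C')"
        by (simp_all add: vol_translate)
    qed
    have ineq: "vol A * vol (A + B + C) \<le> k * ((1 + e) ^ DIM('a) * vol (A + B)) * ((1 + e) ^ DIM('a) * vol (A + C))"
      if e: "e > 0" for e
    proof -
      let ?E = "(*\<^sub>R) e ` A"
      have E: "compact ?E" "convex ?E" "vol ?E > 0" "?E \<noteq> {}"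
        using A vA e by (auto intro: compact_scaling convex_scaling simp: vol_scaleR) (auto simp: vol_def)
      have plus_E: "compact (K + ?E)" "convex (K + ?E)" "vol (K + ?E) > 0"
        if "compact K" "convex K" "0 \<in> K" for K
      proof -
        have "vol ?E \<le> vol (?E + K)" using that E by (intro vol_le_plus) auto
        then show "vol (K + ?E) > 0" using E by (simp add: add.commute)
      qed (intro compact_set_plus convex_set_plus that E)+
      note BE = plus_E[OF B 0(1)] and CE = plus_E[OF C 0(2)]
      have "vol (A + B + C) \<le> vol (A + B + C + (?E + ?E))"
        using E A B C by (intro vol_le_plus compact_set_plus) (auto simp: set_plus_def)
      also have "A + B + C + (?E + ?E) = A + (B + ?E) + (C + ?E)" by (simp add: add_ac)
      finally have "vol A * vol (A + B + C) \<le> vol A * vol (A + (B + ?E) + (C + ?E))"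
        by (intro mult_left_mono) auto
      also have "\<dots> \<le> k * vol (A + (B + ?E)) * vol (A + (C + ?E))"
        by (rule pos[OF vA BE CE])
      also have "\<dots> \<le> k * ((1 + e) ^ DIM('a) * vol (A + B)) * ((1 + e) ^ DIM('a) * vol (A + C))"
        using vol_enlarge_le[OF A B 0(1), of e] vol_enlarge_le[OF A C 0(2), of e] k e
        by (intro mult_mono) auto
      finally show ?thesis .
    qed
    have "vol A * vol (A + B + C) \<le> k * (1 * vol (A + B)) * (1 * vol (A + C))"
    proof (rule tendsto_le[OF trivial_limit_at_right_real _ tendsto_const])
      show "((\<lambda>e. k * ((1 + e) ^ DIM('a) * vol (A + B)) * ((1 + e) ^ DIM('a) * vol (A + C))) \<longlongrightarrow>
          k * (1 * vol (A + B)) * (1 * vol (A + C))) (at_right 0)"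
        by (auto intro!: tendsto_eq_intros)
      show "\<forall>\<^sub>F e in at_right 0. vol A * vol (A + B + C) \<le> k * ((1 + e) ^ DIM('a) * vol (A + B)) * ((1 + e) ^ DIM('a) * vol (A + C))"
        using ineq by (auto simp: eventually_at_filter)
    qed
    then show ?thesis by (simp add: trans)
  qed
qed

lemma vol_submult_four_thirds:
  fixes A :: "(real^3) set"
  assumes A: "compact A" "convex A"
  shows "vol_submult_on (4/3) A"
proof (rule vol_submult_of_positive[OF A])
  fix B C :: "(real^3) set"
  assume vA: "vol A > 0" and B: "compact B" "convex B" "vol B > 0" and C: "compact C" "convex C" "vol C > 0"
  have ne: "A \<noteq> {}" "B \<noteq> {}" "C \<noteq> {}" using vA B C by (auto simp: vol_def)
  obtain p q r s t u m where f: "\<And>x y z. x \<ge> 0 \<Longrightarrow> y \<ge> 0 \<Longrightarrow> z \<ge> 0 \<Longrightarrow>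
       vol (comb3 A B C x y z) = ternary_cubic (vol A) (vol B) (vol C) p q r s t u m x y z"
    "root_superadditive (ternary_cubic (vol A) (vol B) (vol C) p q r s t u m)"
    using volume_ternary_cubic[OF A vA B C] by blast
  have V: "vol (A + B + C) = ternary_cubic (vol A) (vol B) (vol C) p q r s t u m 1 1 1"
    "vol (A + B) = ternary_cubic (vol A) (vol B) (vol C) p q r s t u m 1 1 0"
    "vol (A + C) = ternary_cubic (vol A) (vol B) (vol C) p q r s t u m 1 0 1"
    unfolding set_plus_eq_comb3(1)[OF ne(2,3), of A, THEN arg_cong[of _ _ vol]]
      set_plus_eq_comb3(2,3)[OF ne(2,3), of A, THEN arg_cong[of _ _ vol]]
    by (rule f(1); simp)+
  have "ternary_cubic (vol A) (vol B) (vol C) p q r s t u m 1 0 0 = vol A" by (simp add: ternary_cubic_def)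
  then show "vol A * vol (A + B + C) \<le> 4/3 * vol (A + B) * vol (A + C)"
    using cubic_submultiplicative[OF f(2) vA B(3) C(3)] unfolding V by simp
qed simp

section \<open>Simplices\<close>

definition simplex_scaled :: "'a::real_vector set \<Rightarrow> real \<Rightarrow> 'a set" where
  "simplex_scaled V k = {\<Sum>v\<in>V. u v *\<^sub>R v | u. (\<forall>v\<in>V. u v \<ge> 0) \<and> sum u V = k}"

lemma simplex_scaledI:
  "(\<And>v. v \<in> V \<Longrightarrow> u v \<ge> 0) \<Longrightarrow> sum u V = k \<Longrightarrow> (\<Sum>v\<in>V. u v *\<^sub>R v) \<in> simplex_scaled V k"
  unfolding simplex_scaled_def by blast

lemma simplex_scaledE:
  assumes "x \<in> simplex_scaled V k"
  obtains u where "x = (\<Sum>v\<in>V. u v *\<^sub>R v)" "\<And>v. v \<in> V \<Longrightarrow> u v \<ge> 0" "sum u V = k"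
  using assms unfolding simplex_scaled_def by blast

lemma simplex_scaled_eq:
  fixes V :: "'a::real_vector set"
  assumes V: "finite V" "V \<noteq> {}" and k: "k \<ge> 0"
  shows "simplex_scaled V k = (*\<^sub>R) k ` (convex hull V)"
proof (intro equalityI subsetI)
  fix x assume "x \<in> simplex_scaled V k"
  then obtain u where u: "x = (\<Sum>v\<in>V. u v *\<^sub>R v)" "\<And>v. v \<in> V \<Longrightarrow> u v \<ge> 0" "sum u V = k"
    by (rule simplex_scaledE) blast
  show "x \<in> (*\<^sub>R) k ` (convex hull V)"
  proof (cases "k = 0")
    case True
    then have "\<forall>v\<in>V. u v = 0" using u V by (simp add: sum_nonneg_eq_0_iff)
    then have "x = 0" using u(1) by simp
    moreover obtain v where "v \<in> V" using V by blast
    then have "0 *\<^sub>R v \<in> (*\<^sub>R) 0 ` (convex hull V)" by (intro imageI hull_inc)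
    ultimately show ?thesis using True by simp
  next
    case False
    have "(\<Sum>v\<in>V. (u v / k) *\<^sub>R v) \<in> convex hull V"
      unfolding convex_hull_finite[OF V(1)] using u k False
      by (auto intro!: exI[of _ "\<lambda>v. u v / k"] simp: sum_divide_distrib[symmetric])
    moreover have "x = k *\<^sub>R (\<Sum>v\<in>V. (u v / k) *\<^sub>R v)"
      using False by (simp add: u(1) scaleR_sum_right)
    ultimately show ?thesis by blast
  qed
next
  fix x assume "x \<in> (*\<^sub>R) k ` (convex hull V)"
  then obtain w where w: "\<forall>v\<in>V. w v \<ge> 0" "sum w V = 1" "x = k *\<^sub>R (\<Sum>v\<in>V. w v *\<^sub>R v)"
    unfolding convex_hull_finite[OF V(1)] by blast
  have "(\<Sum>v\<in>V. (k * w v) *\<^sub>R v) \<in> simplex_scaled V k"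
    using w k by (intro simplex_scaledI) (auto simp: sum_distrib_left[symmetric])
  then show "x \<in> simplex_scaled V k" by (simp add: w(3) scaleR_sum_right)
qed

lemma affine_independent_coords_unique:
  assumes V: "finite V" "\<not> affine_dependent V"
    and eq: "(\<Sum>v\<in>V. u v *\<^sub>R v) = (\<Sum>v\<in>V. w v *\<^sub>R v)" "sum u V = sum w V" and v: "v \<in> V"
  shows "u v = w v"
proof (rule ccontr)
  assume "u v \<noteq> w v"
  moreover have "sum (\<lambda>v. u v - w v) V = 0" "(\<Sum>v\<in>V. (u v - w v) *\<^sub>R v) = 0"
    using eq by (simp_all add: sum_subtractf scaleR_diff_left)
  ultimately have "affine_dependent V"
    unfolding affine_dependent_explicit_finite[OF V(1)] using v
    by (intro exI[of _ "\<lambda>v. u v - w v"]) auto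
  then show False using V by blast
qed

lemma barycentric_coords:
  fixes V :: "'a::euclidean_space set"
  assumes V: "finite V" "\<not> affine_dependent V" "affine hull V = UNIV"
  obtains \<phi> :: "'a \<Rightarrow> 'a \<Rightarrow> real" where
    "\<And>x. (\<Sum>v\<in>V. \<phi> v x *\<^sub>R v) = x" "\<And>x. (\<Sum>v\<in>V. \<phi> v x) = 1"
    "\<And>v S. v \<in> V \<Longrightarrow> continuous_on S (\<phi> v)"
proof -
  have "\<forall>x. \<exists>u. sum u V = 1 \<and> (\<Sum>v\<in>V. u v *\<^sub>R v) = x"
    using V(3) unfolding affine_hull_finite[OF V(1)] by blast
  from choice[OF this] obtain \<psi> where "\<forall>x. sum (\<psi> x) V = 1 \<and> (\<Sum>v\<in>V. \<psi> x v *\<^sub>R v) = x" ..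
  then have \<psi>: "sum (\<psi> x) V = 1" "(\<Sum>v\<in>V. \<psi> x v *\<^sub>R v) = x" for x by blast+
  have cont: "continuous_on S (\<lambda>x. \<psi> x v)" if v: "v \<in> V" for v S
  proof -
    have "linear (\<lambda>x. \<psi> x v - \<psi> 0 v)"
    proof (rule linearI)
      fix x y
      have "\<psi> (x + y) v = \<psi> x v + \<psi> y v - \<psi> 0 v"
        by (rule affine_independent_coords_unique[OF V(1,2) _ _ v])
           (simp_all add: \<psi> scaleR_add_left scaleR_diff_left sum.distrib sum_subtractf)
      then show "\<psi> (x + y) v - \<psi> 0 v = \<psi> x v - \<psi> 0 v + (\<psi> y v - \<psi> 0 v)" by simp
    next
      fix r x
      have "\<psi> (r *\<^sub>R x) v = r * \<psi> x v + (1 - r) * \<psi> 0 v"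
        by (rule affine_independent_coords_unique[OF V(1,2) _ _ v])
           (simp_all add: \<psi> scaleR_add_left sum.distrib sum_distrib_left[symmetric]
             scaleR_scaleR[symmetric] scaleR_sum_right[symmetric] del: scaleR_scaleR)
      then show "\<psi> (r *\<^sub>R x) v - \<psi> 0 v = r *\<^sub>R (\<psi> x v - \<psi> 0 v)" by (simp add: algebra_simps)
    qed
    then have "continuous_on S (\<lambda>x. (\<psi> x v - \<psi> 0 v) + \<psi> 0 v)"
      by (intro continuous_intros linear_continuous_on) (simp add: linear_conv_bounded_linear)
    then show ?thesis by simp
  qed
  show thesis by (rule that[of "\<lambda>v x. \<psi> x v"]) (use \<psi> cont in auto)
qed

lemma vol_UN_ge:
  fixes G :: "'b \<Rightarrow> 'a::euclidean_space set"
  assumes "finite I" "I \<noteq> {}" and comp: "\<And>i. i \<in> I \<Longrightarrow> compact (G i)" and H: "compact H"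
    and disj: "\<And>i j. i \<in> I \<Longrightarrow> j \<in> I \<Longrightarrow> i \<noteq> j \<Longrightarrow> G i \<inter> G j \<subseteq> H"
  shows "(\<Sum>i\<in>I. vol (G i)) - (real (card I) - 1) * vol H \<le> vol (\<Union>i\<in>I. G i)"
  using assms(1,2) comp disj
proof (induction I rule: finite_ne_induct)
  case (singleton i)
  then show ?case by simp
next
  case (insert i I)
  have cU: "compact (\<Union>j\<in>I. G j)" "compact (G i)" using insert by (auto intro!: compact_UN)
  have "vol ((\<Union>j\<in>I. G j) \<inter> G i) \<le> vol H"
  proof (rule vol_mono)
    show "(\<Union>j\<in>I. G j) \<inter> G i \<subseteq> H" using insert.prems(2) insert.hyps by blast
    show "compact ((\<Union>j\<in>I. G j) \<inter> G i)" using cU by (simp add: compact_Int)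
  qed (rule H)
  moreover have "vol ((\<Union>j\<in>I. G j) \<union> G i) = vol (\<Union>j\<in>I. G j) + vol (G i) - vol ((\<Union>j\<in>I. G j) \<inter> G i)"
    using measure_Un3[OF lmeasurable_compact[OF cU(1)] lmeasurable_compact[OF cU(2)]]
    by (simp add: vol_def)
  moreover have "(\<Sum>i\<in>I. vol (G i)) - (real (card I) - 1) * vol H \<le> vol (\<Union>i\<in>I. G i)"
    using insert.IH insert.prems by blast
  ultimately show ?case using insert.hyps by (simp add: Un_commute algebra_simps)
qed

text \<open>The homothet of the simplex \<open>A\<close> circumscribed about \<open>C\<close> touches \<open>C\<close> at a point of each facet. The sum
  \<open>A + t C\<close> then contains, for every vertex, a translate of \<open>(1 - 2 t \<rho>) A\<close>, and any two of these four
  translates meet inside one common translate of \<open>(1 - 3 t \<rho>) A\<close>. To first order in \<open>t\<close> the resulting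
  lower bound is \<open>(1 + 3 t \<rho>) vol A\<close>.\<close>

lemma simplex_circumscribed:
  fixes V :: "(real^3) set" and C :: "(real^3) set"
  assumes V: "finite V" "\<not> affine_dependent V" "card V = 4" and C: "compact C" "C \<noteq> {}"
  obtains \<rho> z where "\<rho> \<ge> 0" "C \<subseteq> {z} + (*\<^sub>R) \<rho> ` (convex hull V)"
    "\<And>t. t \<ge> 0 \<Longrightarrow> t * \<rho> \<le> 1/3 \<Longrightarrow>
       (4 * (1 - 2 * (t * \<rho>))^3 - 3 * (1 - 3 * (t * \<rho>))^3) * vol (convex hull V) \<le> vol (convex hull V + (*\<^sub>R) t ` C)"
proof -
  have Vne: "V \<noteq> {}" using V by auto
  have "aff_dim V = 3" using aff_dim_unique[of V] V by (simp add: aff_dim_affine_independent)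
  then have hull: "affine hull V = UNIV" using aff_dim_eq_full[of V] by simp
  obtain \<phi> where \<phi>: "\<And>x. (\<Sum>v\<in>V. \<phi> v x *\<^sub>R v) = x" "\<And>x. (\<Sum>v\<in>V. \<phi> v x) = 1"
    "\<And>v S. v \<in> V \<Longrightarrow> continuous_on S (\<phi> v)"
    using barycentric_coords[OF V(1,2) hull] by blast
  have "\<forall>v\<in>V. \<exists>c. c \<in> C \<and> (\<forall>x\<in>C. \<phi> v c \<le> \<phi> v x)"
    using continuous_attains_inf[OF C \<phi>(3)] by blast
  from bchoice[OF this] obtain c where "\<forall>v\<in>V. c v \<in> C \<and> (\<forall>x\<in>C. \<phi> v (c v) \<le> \<phi> v x)" by blast
  then have c: "\<And>v. v \<in> V \<Longrightarrow> c v \<in> C" "\<And>v x. v \<in> V \<Longrightarrow> x \<in> C \<Longrightarrow> \<phi> v (c v) \<le> \<phi> v x"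
    by blast+
  define \<theta> where "\<theta> v = \<phi> v (c v)" for v
  define \<rho> where "\<rho> = 1 - sum \<theta> V"
  define z where "z = (\<Sum>v\<in>V. \<theta> v *\<^sub>R v)"
  have diff: "x = z + (\<Sum>v\<in>V. (\<phi> v x - \<theta> v) *\<^sub>R v)" for x
    by (simp add: z_def scaleR_diff_left sum_subtractf \<phi>)
  have diff_sum: "(\<Sum>v\<in>V. \<phi> v x - \<theta> v) = \<rho>" for x by (simp add: sum_subtractf \<phi> \<rho>_def)
  have diff_nn: "\<phi> v x - \<theta> v \<ge> 0" if "v \<in> V" "x \<in> C" for v x using c(2)[OF that] by (simp add: \<theta>_def)
  have \<rho>0: "\<rho> \<ge> 0"
  proof -
    obtain x where "x \<in> C" using C by blast
    then have "(\<Sum>v\<in>V. \<phi> v x - \<theta> v) \<ge> 0" using diff_nn by (intro sum_nonneg)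
    then show ?thesis by (simp only: diff_sum)
  qed
  have "C \<subseteq> {z} + simplex_scaled V \<rho>"
  proof
    fix x assume x: "x \<in> C"
    have "(\<Sum>v\<in>V. (\<phi> v x - \<theta> v) *\<^sub>R v) \<in> simplex_scaled V \<rho>"
      using diff_nn x diff_sum by (intro simplex_scaledI) auto
    then show "x \<in> {z} + simplex_scaled V \<rho>" by (subst diff) (intro set_plus_intro singletonI)
  qed
  moreover have "(4 * (1 - 2 * (t * \<rho>))^3 - 3 * (1 - 3 * (t * \<rho>))^3) * vol (convex hull V) \<le> vol (convex hull V + (*\<^sub>R) t ` C)"
    if t: "t \<ge> 0" "t * \<rho> \<le> 1/3" for t
  proof -
    define \<tau> where "\<tau> = t * \<rho>"
    have \<tau>: "0 \<le> \<tau>" "\<tau> \<le> 1/3" using t \<rho>0 by (simp_all add: \<tau>_def)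
    define e where "e v w = (if w = v then 0 else \<tau>)" for v w :: "real^3"
    have e_sum: "sum (e v) V = 3 * \<tau>" if "v \<in> V" for v
    proof -
      have "sum (e v) V = sum (e v) (V - {v})" using V(1) that by (intro sum.mono_neutral_right) (auto simp: e_def)
      also have "\<dots> = (\<Sum>w\<in>V - {v}. \<tau>)" by (intro sum.cong) (auto simp: e_def)
      also have "\<dots> = 3 * \<tau>" using V that by simp
      finally show ?thesis .
    qed
    define G where "G v = {t *\<^sub>R z + (\<Sum>w\<in>V. e v w *\<^sub>R w)} + simplex_scaled V (1 - 2 * \<tau>)" for v
    define H where "H = {t *\<^sub>R z + (\<Sum>w\<in>V. \<tau> *\<^sub>R w)} + simplex_scaled V (1 - 3 * \<tau>)"
    have scal: "simplex_scaled V k = (*\<^sub>R) k ` (convex hull V)" if "k \<ge> 0" for k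
      using simplex_scaled_eq[OF V(1) Vne that] .
    have hc: "compact (convex hull V)" using V(1) by (rule finite_imp_compact_convex_hull)
    have compG: "compact (G v)" for v
      unfolding G_def using \<tau> by (simp add: scal compact_set_plus compact_scaling hc)
    have compH: "compact H"
      unfolding H_def using \<tau> by (simp add: scal compact_set_plus compact_scaling hc)
    have volG: "vol (G v) = (1 - 2 * \<tau>)^3 * vol (convex hull V)" for v
      unfolding G_def vol_translate using \<tau> by (simp add: scal vol_scaleR)
    have volH: "vol H = (1 - 3 * \<tau>)^3 * vol (convex hull V)"
      unfolding H_def vol_translate using \<tau> by (simp add: scal vol_scaleR)
    have GE: "\<exists>u. x = t *\<^sub>R z + (\<Sum>w\<in>V. u w *\<^sub>R w) \<and> sum u V = 1 + \<tau> \<and> (\<forall>w\<in>V. u w \<ge> e v w)"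
      if x: "x \<in> G v" "v \<in> V" for x v
    proof -
      obtain y where y: "x = t *\<^sub>R z + (\<Sum>w\<in>V. e v w *\<^sub>R w) + y" "y \<in> simplex_scaled V (1 - 2 * \<tau>)"
        using x unfolding G_def by (elim set_plus_elim) auto
      obtain u where u: "y = (\<Sum>w\<in>V. u w *\<^sub>R w)" "\<And>w. w \<in> V \<Longrightarrow> u w \<ge> 0" "sum u V = 1 - 2 * \<tau>"
        using y(2) by (rule simplex_scaledE) blast
      show ?thesis
        by (rule exI[of _ "\<lambda>w. e v w + u w"])
           (use u e_sum[OF x(2)] in \<open>auto simp: y(1) scaleR_add_left sum.distrib\<close>)
    qed
    have GH: "G v \<inter> G v' \<subseteq> H" if v: "v \<in> V" "v' \<in> V" "v \<noteq> v'" for v v'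
    proof
      fix x assume x: "x \<in> G v \<inter> G v'"
      obtain u where u: "x = t *\<^sub>R z + (\<Sum>w\<in>V. u w *\<^sub>R w)" "sum u V = 1 + \<tau>" "\<forall>w\<in>V. u w \<ge> e v w"
        using GE[of x v] x v by blast
      obtain u' where u': "x = t *\<^sub>R z + (\<Sum>w\<in>V. u' w *\<^sub>R w)" "sum u' V = 1 + \<tau>" "\<forall>w\<in>V. u' w \<ge> e v' w"
        using GE[of x v'] x v by blast
      have uu: "u w = u' w" if "w \<in> V" for w
        by (rule affine_independent_coords_unique[OF V(1,2) _ _ that]) (use u u' in auto)
      have "u w \<ge> \<tau>" if w: "w \<in> V" for w
        using u(3) u'(3) uu[OF w] w v(3) by (cases "w = v") (auto simp: e_def dest!: bspec)
      then have "(\<Sum>w\<in>V. (u w - \<tau>) *\<^sub>R w) \<in> simplex_scaled V (1 - 3 * \<tau>)"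
        by (intro simplex_scaledI) (use u(2) V(3) in \<open>auto simp: sum_subtractf\<close>)
      moreover have "x = (t *\<^sub>R z + (\<Sum>w\<in>V. \<tau> *\<^sub>R w)) + (\<Sum>w\<in>V. (u w - \<tau>) *\<^sub>R w)"
        by (simp add: u(1) scaleR_diff_left sum_subtractf)
      ultimately show "x \<in> H" unfolding H_def by (simp only: set_plus_intro singletonI)
    qed
    have Gsub: "G v \<subseteq> convex hull V + (*\<^sub>R) t ` C" if v: "v \<in> V" for v
    proof
      fix x assume "x \<in> G v"
      then obtain u where u: "x = t *\<^sub>R z + (\<Sum>w\<in>V. u w *\<^sub>R w)" "sum u V = 1 + \<tau>" "\<forall>w\<in>V. u w \<ge> e v w"
        using GE v by blast
      define d where "d w = \<phi> w (c v) - \<theta> w" for w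
      have d: "d w \<ge> 0" "d w \<le> \<rho>" if "w \<in> V" for w
      proof -
        show "d w \<ge> 0" unfolding d_def using diff_nn[OF that c(1)[OF v]] .
        have "d w \<le> sum d V" using V(1) that diff_nn c(1)[OF v] by (intro member_le_sum) (auto simp: d_def)
        then show "d w \<le> \<rho>" using diff_sum[of "c v"] by (simp add: d_def)
      qed
      have dv: "d v = 0" by (simp add: d_def \<theta>_def)
      have cv: "t *\<^sub>R c v = t *\<^sub>R z + (\<Sum>w\<in>V. (t * d w) *\<^sub>R w)"
        by (subst diff[of "c v"], fold d_def) (simp add: scaleR_add_right scaleR_sum_right)
      have "u w - t * d w \<ge> 0" if w: "w \<in> V" for w
      proof (cases "w = v")
        case True
        then show ?thesis using u(3) w dv by (auto simp: e_def)
      next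
        case False
        have "t * d w \<le> \<tau>" unfolding \<tau>_def using d(2)[OF w] t by (intro mult_left_mono)
        moreover have "u w \<ge> \<tau>" using u(3) w False by (force simp: e_def)
        ultimately show ?thesis by simp
      qed
      moreover have "(\<Sum>w\<in>V. u w - t * d w) = 1"
        using diff_sum[of "c v"] by (simp add: sum_subtractf u(2) sum_distrib_left[symmetric] d_def \<tau>_def)
      ultimately have "(\<Sum>w\<in>V. (u w - t * d w) *\<^sub>R w) \<in> simplex_scaled V 1"
        by (intro simplex_scaledI) auto
      then have "(\<Sum>w\<in>V. (u w - t * d w) *\<^sub>R w) \<in> convex hull V" by (simp add: scal)
      moreover have "x = (\<Sum>w\<in>V. (u w - t * d w) *\<^sub>R w) + t *\<^sub>R c v"
        by (simp add: u(1) cv scaleR_diff_left sum_subtractf)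
      ultimately show "x \<in> convex hull V + (*\<^sub>R) t ` C" using c(1)[OF v] by blast
    qed
    have "(4 * (1 - 2 * \<tau>)^3 - 3 * (1 - 3 * \<tau>)^3) * vol (convex hull V) = (\<Sum>v\<in>V. vol (G v)) - (real (card V) - 1) * vol H"
      by (simp add: volG volH V(3) algebra_simps)
    also have "\<dots> \<le> vol (\<Union>v\<in>V. G v)"
      by (rule vol_UN_ge[OF V(1) Vne compG compH GH])
    also have "\<dots> \<le> vol (convex hull V + (*\<^sub>R) t ` C)"
    proof (rule vol_mono)
      show "(\<Union>v\<in>V. G v) \<subseteq> convex hull V + (*\<^sub>R) t ` C" using Gsub by blast
      show "compact (\<Union>v\<in>V. G v)" using V(1) compG by (intro compact_UN)
      show "compact (convex hull V + (*\<^sub>R) t ` C)" using hc C by (intro compact_set_plus compact_scaling)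
    qed
    finally show ?thesis by (simp add: \<tau>_def)
  qed
  ultimately show thesis unfolding simplex_scaled_eq[OF V(1) Vne \<rho>0] using \<rho>0 by (intro that)
qed

lemma quadratic_first_coeff_le:
  fixes x1 y1 :: real
  assumes \<delta>: "\<delta> > 0" and le: "\<And>t. 0 < t \<Longrightarrow> t < \<delta> \<Longrightarrow> t * (x1 + x2 * t + x3 * t\<^sup>2) \<le> t * (y1 + y2 * t + y3 * t\<^sup>2)"
  shows "x1 \<le> y1"
proof (rule tendsto_le[OF trivial_limit_at_right_real])
  show "((\<lambda>t. x1 + x2 * t + x3 * t\<^sup>2) \<longlongrightarrow> x1) (at_right 0)" "((\<lambda>t. y1 + y2 * t + y3 * t\<^sup>2) \<longlongrightarrow> y1) (at_right 0)"
    by (auto intro!: tendsto_eq_intros)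
  show "\<forall>\<^sub>F t in at_right 0. x1 + x2 * t + x3 * t\<^sup>2 \<le> y1 + y2 * t + y3 * t\<^sup>2"
    unfolding eventually_at_right_field using \<delta> le by (intro exI[of _ \<delta>]) auto
qed

lemma comb3_swap: "comb3 A B C x y z = comb3 A C B x z y"
  by (simp add: comb3_def add_ac)

lemma vol_comb3_absorb:
  fixes A B C :: "'a::euclidean_space set"
  assumes A: "compact A" "convex A" and B: "compact B" and C: "compact C" "C \<noteq> {}" "C \<subseteq> {z} + (*\<^sub>R) \<rho> ` A"
    and nn: "x \<ge> 0" "t \<ge> 0" "\<rho> \<ge> 0"
  shows "vol (comb3 A B C x y t) \<le> vol (comb3 A B C (x + t * \<rho>) y 0)"
proof -
  have "(*\<^sub>R) t ` C \<subseteq> {t *\<^sub>R z} + (*\<^sub>R) (t * \<rho>) ` A"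
  proof
    fix k assume "k \<in> (*\<^sub>R) t ` C"
    then obtain a where "a \<in> A" "k = t *\<^sub>R (z + \<rho> *\<^sub>R a)"
      using C(3) by (force simp: set_plus_def)
    then show "k \<in> {t *\<^sub>R z} + (*\<^sub>R) (t * \<rho>) ` A" by (auto simp: set_plus_def scaleR_add_right)
  qed
  then have "comb3 A B C x y t \<subseteq> (*\<^sub>R) x ` A + (*\<^sub>R) y ` B + ({t *\<^sub>R z} + (*\<^sub>R) (t * \<rho>) ` A)"
    unfolding comb3_def by (intro set_plus_mono2 order.refl)
  also have "\<dots> = {t *\<^sub>R z} + comb3 A B C (x + t * \<rho>) y 0"
    using A nn C(2) by (simp add: comb3_def convex_scaleR_add image_zero_eq_zero add_ac)
  finally have "vol (comb3 A B C x y t) \<le> vol ({t *\<^sub>R z} + comb3 A B C (x + t * \<rho>) y 0)"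
    using A B C by (intro vol_mono compact_comb3 compact_set_plus) auto
  then show ?thesis by (simp add: vol_translate)
qed

lemma vol_submult_simplex:
  fixes A :: "(real^3) set"
  assumes A: "n simplex A"
  shows "vol_submult_on 1 A"
proof (rule vol_submult_of_positive)
  show cA: "compact A" "convex A"
    using A by (auto simp: compact_simplex convex_simplex)
  fix B C :: "(real^3) set"
  assume vA: "vol A > 0" and B: "compact B" "convex B" "vol B > 0" and C: "compact C" "convex C" "vol C > 0"
  have ne: "A \<noteq> {}" "B \<noteq> {}" "C \<noteq> {}" using vA B C by (auto simp: vol_def)
  have "aff_dim A = 3"
    using vol_pos_iff_interior[OF cA] vA aff_dim_nonempty_interior by fastforce
  then have "3 simplex A" using aff_dim_simplex[OF A] A by simp
  then obtain V where V: "finite V" "\<not> affine_dependent V" "card V = 4" "A = convex hull V"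
    unfolding simplex by auto
  obtain p q r s t u m where f: "\<And>x y z. x \<ge> 0 \<Longrightarrow> y \<ge> 0 \<Longrightarrow> z \<ge> 0 \<Longrightarrow>
       vol (comb3 A B C x y z) = ternary_cubic (vol A) (vol B) (vol C) p q r s t u m x y z"
    "root_superadditive (ternary_cubic (vol A) (vol B) (vol C) p q r s t u m)"
    using volume_ternary_cubic[OF cA vA B C] by blast
  define a b c where "a = vol A" and "b = vol B" and "c = vol C"
  have abc: "a > 0" "b > 0" "c > 0" using vA B C by (simp_all add: a_def b_def c_def)
  note f = f[folded a_def b_def c_def]
  note nn = mixed_coefficient_bounds(1-6)[OF f(2) abc]
  obtain \<rho> z where \<rho>: "\<rho> \<ge> 0" "C \<subseteq> {z} + (*\<^sub>R) \<rho> ` A"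
    "\<And>t. t \<ge> 0 \<Longrightarrow> t * \<rho> \<le> 1/3 \<Longrightarrow> (4 * (1 - 2 * (t * \<rho>))^3 - 3 * (1 - 3 * (t * \<rho>))^3) * a \<le> vol (A + (*\<^sub>R) t ` C)"
    using simplex_circumscribed[OF V(1-3) C(1) ne(3), folded V(4)] unfolding a_def by blast
  obtain \<mu> w where \<mu>: "\<mu> \<ge> 0" "B \<subseteq> {w} + (*\<^sub>R) \<mu> ` A"
    "\<And>t. t \<ge> 0 \<Longrightarrow> t * \<mu> \<le> 1/3 \<Longrightarrow> (4 * (1 - 2 * (t * \<mu>))^3 - 3 * (1 - 3 * (t * \<mu>))^3) * a \<le> vol (A + (*\<^sub>R) t ` B)"
    using simplex_circumscribed[OF V(1-3) B(1) ne(2), folded V(4)] unfolding a_def by blast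
  have small: "t * \<kappa> \<le> 1/3" if "0 < t" "t < 1 / (3 * (\<kappa> + 1))" "\<kappa> \<ge> 0" for t \<kappa> :: real
  proof -
    have "t * (3 * (\<kappa> + 1)) < 1" using that by (simp add: pos_less_divide_eq)
    then show ?thesis using that by (simp add: algebra_simps)
  qed
  have "3 * \<rho> * a \<le> 3 * r"
  proof (rule quadratic_first_coeff_le[where \<delta> = "1 / (3 * (\<rho> + 1))"])
    fix \<tau> :: real assume \<tau>: "0 < \<tau>" "\<tau> < 1 / (3 * (\<rho> + 1))"
    have "vol (A + (*\<^sub>R) \<tau> ` C) = ternary_cubic a b c p q r s t u m 1 0 \<tau>"
      using f(1)[of 1 0 \<tau>] \<tau> ne by (simp add: comb3_def image_zero_eq_zero)
    then have "(4 * (1 - 2 * (\<tau> * \<rho>))^3 - 3 * (1 - 3 * (\<tau> * \<rho>))^3) * a \<le> ternary_cubic a b c p q r s t u m 1 0 \<tau>"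
      using \<rho>(3)[of \<tau>] small[OF \<tau> \<rho>(1)] \<tau> by simp
    then show "\<tau> * (3 * \<rho> * a + (- 33 * \<rho>\<^sup>2 * a) * \<tau> + (49 * \<rho>^3 * a) * \<tau>\<^sup>2) \<le> \<tau> * (3 * r + (3 * s) * \<tau> + c * \<tau>\<^sup>2)"
      by (simp add: ternary_cubic_def power2_eq_square power3_eq_cube algebra_simps)
  qed (use \<rho> in auto)
  then have ra: "\<rho> * a \<le> r" by simp
  have "3 * \<mu> * a \<le> 3 * p"
  proof (rule quadratic_first_coeff_le[where \<delta> = "1 / (3 * (\<mu> + 1))"])
    fix \<tau> :: real assume \<tau>: "0 < \<tau>" "\<tau> < 1 / (3 * (\<mu> + 1))"
    have "vol (A + (*\<^sub>R) \<tau> ` B) = ternary_cubic a b c p q r s t u m 1 \<tau> 0"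
      using f(1)[of 1 \<tau> 0] \<tau> ne by (simp add: comb3_def image_zero_eq_zero)
    then have "(4 * (1 - 2 * (\<tau> * \<mu>))^3 - 3 * (1 - 3 * (\<tau> * \<mu>))^3) * a \<le> ternary_cubic a b c p q r s t u m 1 \<tau> 0"
      using \<mu>(3)[of \<tau>] small[OF \<tau> \<mu>(1)] \<tau> by simp
    then show "\<tau> * (3 * \<mu> * a + (- 33 * \<mu>\<^sup>2 * a) * \<tau> + (49 * \<mu>^3 * a) * \<tau>\<^sup>2) \<le> \<tau> * (3 * p + (3 * q) * \<tau> + b * \<tau>\<^sup>2)"
      by (simp add: ternary_cubic_def power2_eq_square power3_eq_cube algebra_simps)
  qed (use \<mu> in auto)
  then have pa: "\<mu> * a \<le> p" by simp
  have "3 * (r + 2 * m + t) \<le> 3 * \<rho> * (a + 2 * p + q)"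
  proof (rule quadratic_first_coeff_le[where \<delta> = 1])
    fix \<tau> :: real assume \<tau>: "0 < \<tau>"
    have "ternary_cubic a b c p q r s t u m 1 1 \<tau> \<le> ternary_cubic a b c p q r s t u m (1 + \<tau> * \<rho>) 1 0"
      using vol_comb3_absorb[OF cA B(1) C(1) ne(3) \<rho>(2), of 1 \<tau> 1] \<tau> \<rho>(1) by (simp add: f(1))
    then show "\<tau> * (3 * (r + 2 * m + t) + 3 * (s + u) * \<tau> + c * \<tau>\<^sup>2)
        \<le> \<tau> * (3 * \<rho> * (a + 2 * p + q) + (3 * \<rho>\<^sup>2 * (a + p)) * \<tau> + (a * \<rho>^3) * \<tau>\<^sup>2)"
      by (simp add: ternary_cubic_def power2_eq_square power3_eq_cube algebra_simps)
  qed simp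
  then have D1: "r + 2 * m + t \<le> \<rho> * (a + 2 * p + q)" by simp
  have "3 * u \<le> 3 * \<mu> * s"
  proof (rule quadratic_first_coeff_le[where \<delta> = 1])
    fix \<tau> :: real assume \<tau>: "0 < \<tau>"
    have "ternary_cubic a b c p q r s t u m 0 \<tau> 1 \<le> ternary_cubic a b c p q r s t u m (\<tau> * \<mu>) 0 1"
      using vol_comb3_absorb[OF cA C(1) B(1) ne(2) \<mu>(2), of 0 \<tau> 1] \<tau> \<mu>(1)
      by (simp add: f(1) comb3_swap[of A C B])
    then show "\<tau> * (3 * u + (3 * t) * \<tau> + b * \<tau>\<^sup>2)
        \<le> \<tau> * (3 * \<mu> * s + (3 * r * \<mu>\<^sup>2) * \<tau> + (a * \<mu>^3) * \<tau>\<^sup>2)"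
      by (simp add: ternary_cubic_def power2_eq_square power3_eq_cube algebra_simps)
  qed simp
  then have D2: "u \<le> \<mu> * s" by simp
  have "a * (r + 2 * m + t) \<le> a * (\<rho> * (a + 2 * p + q))"
    using D1 abc by (intro mult_left_mono) auto
  also have "\<dots> = (\<rho> * a) * (a + 2 * p + q)" by simp
  also have "\<dots> \<le> r * (a + 2 * p + q)"
    using ra abc nn by (intro mult_right_mono) auto
  finally have E1: "a * (2 * m + t) \<le> r * (2 * p + q)" by (simp add: algebra_simps)
  have "a * u \<le> a * (\<mu> * s)" using D2 abc by (intro mult_left_mono) auto
  also have "\<dots> = (\<mu> * a) * s" by simp
  also have "\<dots> \<le> p * s" using pa nn by (intro mult_right_mono) auto
  finally have E2: "a * u \<le> p * s" .
  have V: "vol (A + B + C) = ternary_cubic a b c p q r s t u m 1 1 1"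
    "vol (A + B) = ternary_cubic a b c p q r s t u m 1 1 0"
    "vol (A + C) = ternary_cubic a b c p q r s t u m 1 0 1"
    unfolding set_plus_eq_comb3(1)[OF ne(2,3), of A, THEN arg_cong[of _ _ vol]]
      set_plus_eq_comb3(2,3)[OF ne(2,3), of A, THEN arg_cong[of _ _ vol]]
    by (rule f(1); simp)+
  have "0 \<le> 3 * (p * r) + 6 * (p * s) + 6 * (q * r) + 9 * (q * s) + 3 * p * c + 3 * q * c + b * (3 * r + 3 * s + c)"
    using nn abc by (intro add_nonneg_nonneg mult_nonneg_nonneg) auto
  then have "a * ternary_cubic a b c p q r s t u m 1 1 1 \<le> ternary_cubic a b c p q r s t u m 1 1 0 * ternary_cubic a b c p q r s t u m 1 0 1"
    using E1 E2 by (simp add: ternary_cubic_def algebra_simps)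
  then show "vol A * vol (A + B + C) \<le> 1 * vol (A + B) * vol (A + C)"
    unfolding V a_def[symmetric] by simp
qed simp

section \<open>Optimality of the constant\<close>

definition pyramid :: "(real^3) set" where
  "pyramid = {x. 0 \<le> x $ 1 \<and> x $ 1 \<le> x $ 3 \<and> 0 \<le> x $ 2 \<and> x $ 2 \<le> x $ 3 \<and> x $ 3 \<le> 1}"

lemma compact_coordinate_set:
  fixes S :: "(real^3) set"
  assumes "closed S" "S \<subseteq> cbox 0 b"
  shows "compact S"
  using assms bounded_subset[OF bounded_cbox] by (auto simp: compact_eq_bounded_closed)

lemma orthogonal_coordinate_swaps:
  "orthogonal_transformation (\<lambda>x::real^3. vector [x $ 2, x $ 1, x $ 3] :: real^3)"
  "orthogonal_transformation (\<lambda>x::real^3. vector [x $ 3, x $ 2, x $ 1] :: real^3)"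
  "orthogonal_transformation (\<lambda>x::real^3. vector [x $ 1, x $ 3, x $ 2] :: real^3)"
  unfolding orthogonal_transformation_def
  by (auto intro!: linearI simp: vec_eq_iff forall_3 inner_vec_def sum_3 vector_3)

lemma vol_orthogonal_image:
  fixes f :: "real^'n::{finite,wellorder} \<Rightarrow> real^'n::_"
  assumes "orthogonal_transformation f" "compact S"
  shows "vol (f ` S) = vol S"
  unfolding vol_def using assms by (intro measure_orthogonal_image lmeasurable_compact)

lemma compact_orthogonal_image:
  fixes f :: "'a::euclidean_space \<Rightarrow> 'a"
  assumes "orthogonal_transformation f" "compact S"
  shows "compact (f ` S)"
proof -
  have "bounded_linear f"
    using orthogonal_transformation_linear[OF assms(1)] linear_conv_bounded_linear by blast
  then show ?thesis using assms(2) by (intro compact_continuous_image linear_continuous_on)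
qed

lemma compact_pyramid: "compact pyramid"
proof (rule compact_coordinate_set)
  show "closed pyramid" unfolding pyramid_def
    by (intro closed_Collect_conj closed_Collect_le continuous_intros)
  show "pyramid \<subseteq> cbox 0 (vector [1, 1, 1])"
    by (auto simp: pyramid_def mem_box_cart forall_3 vector_3)
qed

lemma convex_pyramid: "convex pyramid"
proof (rule convexI)
  fix x y :: "real^3" and u v :: real
  assume xy: "x \<in> pyramid" "y \<in> pyramid" and uv: "0 \<le> u" "0 \<le> v" "u + v = 1"
  have "u * x $ 1 + v * y $ 1 \<le> u * x $ 3 + v * y $ 3" "u * x $ 2 + v * y $ 2 \<le> u * x $ 3 + v * y $ 3"
    using xy uv by (auto simp: pyramid_def intro!: add_mono mult_left_mono)
  moreover have "u * x $ 3 + v * y $ 3 \<le> 1" using xy uv by (auto simp: pyramid_def intro!: convex_bound_le)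
  ultimately show "u *\<^sub>R x + v *\<^sub>R y \<in> pyramid"
    using xy uv by (auto simp: pyramid_def)
qed

lemma vol_box3:
  assumes "0 \<le> a" "0 \<le> b" "0 \<le> c"
  shows "vol (cbox 0 (vector [a, b, c] :: real^3)) = a * b * c"
proof -
  have "cbox 0 (vector [a, b, c] :: real^3) \<noteq> {}"
    using assms by (simp add: interval_ne_empty_cart forall_3 vector_3)
  then have "vol (cbox 0 (vector [a, b, c] :: real^3)) = (\<Prod>i\<in>UNIV. (vector [a, b, c] :: real^3) $ i)"
    by (simp add: vol_def content_cbox_cart)
  also have "\<dots> = a * b * c"
    unfolding UNIV_3 by (simp add: vector_3 mult.assoc)
  finally show ?thesis .
qed

lemma vol_pyramid_ge: "vol pyramid \<ge> 1/3"
proof -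
  let ?f = "\<lambda>x::real^3. vector [x $ 3, x $ 2, x $ 1] :: real^3"
  let ?g = "\<lambda>x::real^3. vector [x $ 1, x $ 3, x $ 2] :: real^3"
  have comp: "compact (?f ` pyramid)" "compact (?g ` pyramid)"
    by (intro compact_orthogonal_image orthogonal_coordinate_swaps compact_pyramid)+
  have "cbox 0 (vector [1, 1, 1]) \<subseteq> pyramid \<union> (?f ` pyramid \<union> ?g ` pyramid)"
  proof
    fix x :: "real^3" assume x: "x \<in> cbox 0 (vector [1, 1, 1])"
    then have "x \<in> pyramid \<or> ?f x \<in> pyramid \<or> ?g x \<in> pyramid"
      by (auto simp: pyramid_def mem_box_cart forall_3 vector_3)
    moreover have "x = ?f (?f x)" "x = ?g (?g x)" by (simp_all add: vec_eq_iff forall_3 vector_3)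
    ultimately show "x \<in> pyramid \<union> (?f ` pyramid \<union> ?g ` pyramid)" by blast
  qed
  then have "vol (cbox 0 (vector [1, 1, 1] :: real^3)) \<le> vol (pyramid \<union> (?f ` pyramid \<union> ?g ` pyramid))"
    using comp compact_pyramid by (intro vol_mono compact_Un) auto
  also have "\<dots> \<le> vol pyramid + vol (?f ` pyramid \<union> ?g ` pyramid)"
    unfolding vol_def using comp compact_pyramid
    by (intro measure_Un_le fmeasurableD lmeasurable_compact compact_Un)
  also have "vol (?f ` pyramid \<union> ?g ` pyramid) \<le> vol (?f ` pyramid) + vol (?g ` pyramid)"
    unfolding vol_def using comp by (intro measure_Un_le fmeasurableD lmeasurable_compact)
  also have "\<dots> = vol pyramid + vol pyramid"
    by (simp add: vol_orthogonal_image orthogonal_coordinate_swaps compact_pyramid)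
  finally show ?thesis using vol_box3[of 1 1 1] by simp
qed

definition wedge :: "real \<Rightarrow> (real^3) set" where
  "wedge s = {x. 0 \<le> x $ 1 \<and> x $ 1 \<le> s + 1 \<and> 0 \<le> x $ 2 \<and> x $ 2 \<le> x $ 3 \<and> x $ 3 \<le> 1}"

lemma compact_wedge: "compact (wedge s)"
proof (rule compact_coordinate_set)
  show "closed (wedge s)" unfolding wedge_def
    by (intro closed_Collect_conj closed_Collect_le continuous_intros)
  show "wedge s \<subseteq> cbox 0 (vector [s + 1, 1, 1])"
    by (auto simp: wedge_def mem_box_cart forall_3 vector_3)
qed

lemma vol_wedge_le:
  assumes s: "s \<ge> 0"
  shows "vol (wedge s) \<le> (s + 1) / 2"
proof -
  let ?g = "\<lambda>x::real^3. vector [x $ 1, x $ 3, x $ 2] :: real^3"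
  have comp: "compact (?g ` wedge s)"
    by (intro compact_orthogonal_image orthogonal_coordinate_swaps compact_wedge)+
  have "wedge s \<inter> ?g ` wedge s \<subseteq> {x. (axis 2 1 - axis 3 1) \<bullet> x = 0}"
    by (auto simp: wedge_def vector_3 inner_diff_left inner_axis')
  moreover have "(axis 2 1 - axis 3 1 :: real^3) \<noteq> 0" by (simp add: axis_eq_axis)
  then have "negligible {x. (axis 2 1 - axis 3 1 :: real^3) \<bullet> x = 0}" by (intro negligible_hyperplane) auto
  ultimately have neg: "measure lebesgue (wedge s \<inter> ?g ` wedge s) = 0"
    using negligible_subset negligible_imp_measure0 by blast
  have "vol (wedge s \<union> ?g ` wedge s) = vol (wedge s) + vol (?g ` wedge s)"
    using measure_Un3[OF lmeasurable_compact[OF compact_wedge] lmeasurable_compact[OF comp], of s] neg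
    by (simp add: vol_def)
  also have "\<dots> = 2 * vol (wedge s)"
    by (simp add: vol_orthogonal_image orthogonal_coordinate_swaps compact_wedge)
  finally have "2 * vol (wedge s) = vol (wedge s \<union> ?g ` wedge s)" ..
  also have "\<dots> \<le> vol (cbox 0 (vector [s + 1, 1, 1] :: real^3))"
    using comp compact_wedge s
    by (intro vol_mono compact_Un) (auto simp: wedge_def mem_box_cart forall_3 vector_3)
  also have "\<dots> = s + 1" using s by (simp add: vol_box3)
  finally show ?thesis by simp
qed

lemma submult_constant_ge_four_thirds:
  fixes k :: real
  assumes k: "k > 0" and sub: "vol_submult_on k pyramid"
  shows "k \<ge> 4/3"
proof (rule ccontr)
  assume "\<not> k \<ge> 4/3"
  define B where "B s = closed_segment 0 (s *\<^sub>R axis 1 1 :: real^3)" for s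
  define C where "C s = closed_segment 0 (s *\<^sub>R axis 2 1 :: real^3)" for s
  let ?h = "\<lambda>x::real^3. vector [x $ 2, x $ 1, x $ 3] :: real^3"
  have ineq: "1/3 * s\<^sup>2 \<le> k * ((s + 1) / 2)\<^sup>2" if s: "s \<ge> 0" for s
  proof -
    have BC: "compact (B s)" "convex (B s)" "compact (C s)" "convex (C s)" by (auto simp: B_def C_def)
    have Bx: "\<exists>\<tau>. b = \<tau> *\<^sub>R axis 1 1 \<and> 0 \<le> \<tau> \<and> \<tau> \<le> s" if "b \<in> B s" for b
      using that s unfolding B_def in_segment by (force intro: mult_left_le_one_le)
    have Cx: "\<exists>\<tau>. c = \<tau> *\<^sub>R axis 2 1 \<and> 0 \<le> \<tau> \<and> \<tau> \<le> s" if "c \<in> C s" for c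
      using that s unfolding C_def in_segment by (force intro: mult_left_le_one_le)
    have seg: "\<tau> *\<^sub>R e \<in> closed_segment 0 (s *\<^sub>R e)" if "0 \<le> \<tau>" "\<tau> \<le> s" for \<tau> and e :: "real^3"
      unfolding in_segment using that by (intro exI[of _ "\<tau> / s"]) (cases "s = 0"; auto)
    have "vol (pyramid + B s) \<le> vol (wedge s)"
    proof (intro vol_mono compact_set_plus compact_pyramid compact_wedge BC subsetI)
      fix x assume "x \<in> pyramid + B s"
      then obtain a b where x: "x = a + b" "a \<in> pyramid" "b \<in> B s" by (elim set_plus_elim)
      then obtain \<tau> where "b = \<tau> *\<^sub>R axis 1 1" "0 \<le> \<tau>" "\<tau> \<le> s" using Bx by blast
      then show "x \<in> wedge s" using x by (auto simp: pyramid_def wedge_def axis_def)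
    qed
    also note vol_wedge_le[OF s]
    finally have AB: "vol (pyramid + B s) \<le> (s + 1) / 2" .
    have comph: "compact (?h ` wedge s)"
      by (intro compact_orthogonal_image orthogonal_coordinate_swaps compact_wedge)+
    have "vol (pyramid + C s) \<le> vol (?h ` wedge s)"
    proof (intro vol_mono compact_set_plus compact_pyramid comph BC subsetI)
      fix x assume "x \<in> pyramid + C s"
      then obtain a b where x: "x = a + b" "a \<in> pyramid" "b \<in> C s" by (elim set_plus_elim)
      then obtain \<tau> where "b = \<tau> *\<^sub>R axis 2 1" "0 \<le> \<tau>" "\<tau> \<le> s" using Cx by blast
      then have "?h x \<in> wedge s" using x by (auto simp: pyramid_def wedge_def axis_def vector_3)
      moreover have "x = ?h (?h x)" by (simp add: vec_eq_iff forall_3 vector_3)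
      ultimately show "x \<in> ?h ` wedge s" by blast
    qed
    also have "\<dots> = vol (wedge s)"
      by (simp add: vol_orthogonal_image orthogonal_coordinate_swaps compact_wedge)
    also note vol_wedge_le[OF s]
    finally have AC: "vol (pyramid + C s) \<le> (s + 1) / 2" .
    have "vol (cbox 0 (vector [s, s, 1] :: real^3)) \<le> vol (pyramid + B s + C s)"
    proof (intro vol_mono compact_set_plus compact_pyramid compact_cbox BC subsetI)
      fix x :: "real^3" assume x: "x \<in> cbox 0 (vector [s, s, 1])"
      have "vector [0, 0, x $ 3] \<in> pyramid" using x by (auto simp: pyramid_def mem_box_cart forall_3 vector_3)
      moreover have "x $ 1 *\<^sub>R axis 1 1 \<in> B s" "x $ 2 *\<^sub>R axis 2 1 \<in> C s"
        unfolding B_def C_def using x by (auto simp: mem_box_cart forall_3 vector_3 intro!: seg)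
      ultimately have "vector [0, 0, x $ 3] + x $ 1 *\<^sub>R axis 1 1 + x $ 2 *\<^sub>R axis 2 1 \<in> pyramid + B s + C s"
        by (intro set_plus_intro)
      moreover have "x = vector [0, 0, x $ 3] + x $ 1 *\<^sub>R axis 1 1 + x $ 2 *\<^sub>R axis 2 1"
        by (simp add: vec_eq_iff forall_3 vector_3 axis_def)
      ultimately show "x \<in> pyramid + B s + C s" by simp
    qed
    then have ABC: "s\<^sup>2 \<le> vol (pyramid + B s + C s)" using s by (simp add: vol_box3 power2_eq_square)
    have "1/3 * s\<^sup>2 \<le> vol pyramid * vol (pyramid + B s + C s)"
      using vol_pyramid_ge ABC by (intro mult_mono) auto
    also have "\<dots> \<le> k * vol (pyramid + B s) * vol (pyramid + C s)"
      using sub BC unfolding vol_submult_on_def by blast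
    also have "\<dots> \<le> k * ((s + 1) / 2) * ((s + 1) / 2)"
      using AB AC k s by (intro mult_mono) auto
    finally show ?thesis by (simp add: power2_eq_square)
  qed
  define d where "d = 4/3 - k"
  have d: "d > 0" using \<open>\<not> k \<ge> 4/3\<close> by (simp add: d_def)
  define s where "s = 4 / d + 1"
  have s: "s \<ge> 1" "d * s > 4" using d by (simp_all add: s_def field_simps)
  have "4/3 * s\<^sup>2 \<le> k * (s + 1)\<^sup>2" using ineq[of s] s by (simp add: power_divide)
  then have "d * s\<^sup>2 \<le> k * (2 * s + 1)" by (simp add: d_def power2_eq_square algebra_simps)
  also have "\<dots> \<le> 4/3 * (3 * s)" using d s by (intro mult_mono) (auto simp: d_def)
  finally have "(d * s) * s \<le> 4 * s" by (simp add: power2_eq_square algebra_simps)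
  then show False using s by simp
qed

theorem theorem4p7:
  shows "(\<forall>A B C :: (real^3) set.
            compact A \<and> convex A \<and> compact B \<and> convex B \<and> compact C \<and> convex C
            \<longrightarrow> vol A * vol (A + B + C) \<le> 4/3 * vol (A + B) * vol (A + C))
       \<and> best_const TYPE(real^3) = 4/3
       \<and> (\<forall>A B C :: (real^3) set.
            compact A \<and> convex A \<and> compact B \<and> convex B \<and> compact C \<and> convex C
            \<and> (\<exists>n. n simplex A)
            \<longrightarrow> vol A * vol (A + B + C) \<le> vol (A + B) * vol (A + C))"
proof (intro conjI)
  show upper: "\<forall>A B C :: (real^3) set.
            compact A \<and> convex A \<and> compact B \<and> convex B \<and> compact C \<and> convex C
            \<longrightarrow> vol A * vol (A + B + C) \<le> 4/3 * vol (A + B) * vol (A + C)"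
    using vol_submult_four_thirds unfolding vol_submult_on_def by blast
  show "best_const TYPE(real^3) = 4/3"
    unfolding best_const_def
  proof (rule cInf_eq_minimum)
    fix k :: real
    assume "k \<in> {c. c > 0 \<and> (\<forall>A B C :: (real^3) set.
      compact A \<and> convex A \<and> compact B \<and> convex B \<and> compact C \<and> convex C
        \<longrightarrow> vol A * vol (A + B + C) \<le> c * vol (A + B) * vol (A + C))}"
    then have "k > 0" "vol_submult_on k pyramid"
      using compact_pyramid convex_pyramid unfolding vol_submult_on_def by blast+
    then show "4/3 \<le> k" by (rule submult_constant_ge_four_thirds)
  qed (use upper in simp)
  show "\<forall>A B C :: (real^3) set.
            compact A \<and> convex A \<and> compact B \<and> convex B \<and> compact C \<and> convex C
            \<and> (\<exists>n. n simplex A)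
            \<longrightarrow> vol A * vol (A + B + C) \<le> vol (A + B) * vol (A + C)"
    using vol_submult_simplex unfolding vol_submult_on_def by fastforce
qed

end
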